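(* Consider the delayed system $$\frac{du_i}{dt}=-d_i(t)u_i(t)+\sum_{j=1}^n a_{ij}(t)g_j(u_j(t))+\sum_{j=1}^n\int_0^\infty f_j\big(u_j(t-\tau_{ij}(t)-s)\big)\,dK_{ij}(t,s)+I_i(t),\qquad i=1,\dots,n,\tag{S}$$ and suppose that Assumption A (stated in full in the context) holds. Suppose there exist $\xi_i>0$, $i=1,\dots,n$, and $\beta>0$ such that $$-[d_i(t)-\beta]\xi_i+\sum_{j=1}^n|a_{ij}(t)|G_j\xi_j+\sum_{j=1}^nF_j\xi_je^{\beta\tau^\star_{ij}}\int_0^\infty e^{\beta s}|dK_{ij}(t,s)|<0$$ for all $t>0$ and all $i=1,\dots,n$; in particular, this is the case if $$-[d_i-\beta]\xi_i+\sum_{j=1}^n|a^\star_{ij}|G_j\xi_j+\sum_{j=1}^nF_j\xi_je^{\beta\tau^\star_{ij}}\int_0^\infty e^{\beta s}|dK_{ij}(s)|<0,\qquad i=1,\dots,n.$$ Then the system (S) has a unique almost periodic solution $v(t)=[v_1(t),\dots,v_n(t)]^T$, and for any solution $u(t)=[u_1(t),\dots,u_n(t)]^T$ of (S), $$\|u(t)-v(t)\|=O(e^{-\beta t}).$$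
   Context: Assumption A consists of the following five items, where $i,j$ range over $1,\dots,n$ and the coefficients are functions of $t\in\mathbb R$. 1. Each $g_j:\mathbb R\to\mathbb R$ is non-decreasing and satisfies $|g_j(x+u)-g_j(x)|\le G_j|u|$ for all $x,u$, with a constant $G_j>0$; each $f_j:\mathbb R\to\mathbb R$ satisfies $|f_j(x+u)-f_j(x)|\le F_j|u|$ for all $x,u$, with a constant $F_j>0$ (no monotonicity required). 2. $d_i(t)$, $a_{ij}(t)$, $\tau_{ij}(t)\ge0$ and $I_i(t)$ are continuous, and $d_i(t)\ge d_i>0$ with constants $d_i$. 3. For any $s\in\mathbb R$, $t\mapsto K_{ij}(t,s)$ is continuous, and for any $t\in\mathbb R$, $dK_{ij}(t,s)$ is a Lebesgue–Stieltjes measure in the variable $s$; $|dK_{ij}(t,s)|$ denotes its total variation measure. 4. For any $\epsilon>0$ there is $l=l(\epsilon)>0$ such that every interval $[\alpha,\alpha+l]$ contains at least one number $\omega$ for which $|d_i(t+\omega)-d_i(t)|<\epsilon$, $|a_{ij}(t+\omega)-a_{ij}(t)|<\epsilon$, $|I_i(t+\omega)-I_i(t)|<\epsilon$, $|\tau_{ij}(t+\omega)-\tau_{ij}(t)|<\epsilon$ and $\int_0^\infty|dK_{ij}(t+\omega,s)-dK_{ij}(t,s)|<\epsilon$ hold for all $i,j$ and all $t\in\mathbb R$. 5. There are Lebesgue–Stieltjes measures $dK_{ij}(s)$ on $[0,\infty)$, independent of $t$, with $|dK_{ij}(t,s)|\le|dK_{ij}(s)|$ for all $t$, and $\int_0^\infty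 e^{\epsilon s}|dK_{ij}(s)|<\infty$ for some $\epsilon>0$. Notation: $|a^\star_{ij}|=\sup_{t\in\mathbb R}|a_{ij}(t)|$ and $\tau^\star_{ij}=\sup_{t\in\mathbb R}\tau_{ij}(t)$ (finite under Assumption A). Solutions of (S) are taken with initial conditions $u_i(s)=\phi_i(s)$ for $s\in(-\infty,0]$, where $\phi_i\in C((-\infty,0])$, $i=1,\dots,n$. A continuous $x:\mathbb R\to\mathbb R^n$ is almost periodic (Bohr) if for any $\epsilon>0$ there is $l=l(\epsilon)>0$ such that every interval of length $l(\epsilon)$ contains a number $\omega$ with $\|x(t+\omega)-x(t)\|<\epsilon$ for all $t\in\mathbb R$. An almost periodic solution is a solution that is an almost periodic function. The norm is $\|u\|_{\{\xi,\infty\}}=\max_i|\xi_i^{-1}u_i|$.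
   Formalization: The rate O(e^{-βt}) is proved for solutions whose initial data satisfy sup_{s≤0} e^{βs}|u(s)| < ∞ (e.g. bounded φ); for arbitrary unbounded continuous φ the claim fails, e.g. for kernels with sparse atoms and tall bumps in φ. *)

theory Defs
  imports "HOL-Analysis.Analysis" "HOL-Library.Landau_Symbols"
begin

definition variation_sums :: "(real \<Rightarrow> real) \<Rightarrow> real \<Rightarrow> real \<Rightarrow> real set" where
  "variation_sums k a b =
     {(\<Sum>m<N. \<bar>k (x (Suc m)) - k (x m)\<bar>) | (x :: nat \<Rightarrow> real) (N :: nat).
        incseq x \<and> x 0 = a \<and> x N = b}"

definition variation :: "(real \<Rightarrow> real) \<Rightarrow> real \<Rightarrow> real \<Rightarrow> real" where
  "variation k a b = Sup (variation_sums k a b)"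

(* Integrators are normalised to be right-continuous, as for interval_measure, so that
   dk has mass k b - k a on {a<..b}. *)
definition ls_integrator :: "(real \<Rightarrow> real) \<Rightarrow> bool" where
  "ls_integrator k \<longleftrightarrow>
     (\<forall>s. continuous (at_right s) k) \<and>
     (\<forall>a b. a \<le> b \<longrightarrow> bdd_above (variation_sums k a b))"

(* The variation function, based at 0; the base point does not affect the measure below. *)
definition variation_fun :: "(real \<Rightarrow> real) \<Rightarrow> real \<Rightarrow> real" where
  "variation_fun k s = (if 0 \<le> s then variation k 0 s else - variation k s 0)"

(* The total variation measure |dk| of the signed Lebesgue-Stieltjes measure dk. *)
definition ls_abs :: "(real \<Rightarrow> real) \<Rightarrow> real measure" where
  "ls_abs k = interval_measure (variation_fun k)"

(* The Lebesgue-Stieltjes integral over [0,\<infinity>) against the signed measure dk = dV - d(V - k),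
   where V is the variation function of k. The point 0 is included: a jump of k at 0
   contributes, which is how undelayed or purely discrete delays are expressed. *)
definition ls_integral :: "(real \<Rightarrow> real) \<Rightarrow> (real \<Rightarrow> real) \<Rightarrow> real" where
  "ls_integral k h =
     (LINT s:{0..}|interval_measure (variation_fun k). h s) -
     (LINT s:{0..}|interval_measure (\<lambda>s. variation_fun k s - k s). h s)"

(* K i j t is the function s \<mapsto> K_ij(t,s) on the real line; Kb i j is the integrator of the
   dominating measure dK_ij(s); dl i, G j, F j are the constants d_i, G_j, F_j.
   The last line requires dK_ij(s) to be carried by [0,\<infinity>); by the domination so is every
   dK_ij(t,s). *)
definition assumption_A ::
  "('n::finite \<Rightarrow> real \<Rightarrow> real) \<Rightarrow> ('n \<Rightarrow> 'n \<Rightarrow> real \<Rightarrow> real) \<Rightarrow> ('n \<Rightarrow> real \<Rightarrow> real) \<Rightarrow>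
   ('n \<Rightarrow> real \<Rightarrow> real) \<Rightarrow> ('n \<Rightarrow> 'n \<Rightarrow> real \<Rightarrow> real) \<Rightarrow> ('n \<Rightarrow> 'n \<Rightarrow> real \<Rightarrow> real \<Rightarrow> real) \<Rightarrow>
   ('n \<Rightarrow> real \<Rightarrow> real) \<Rightarrow> ('n \<Rightarrow> real) \<Rightarrow> ('n \<Rightarrow> real) \<Rightarrow> ('n \<Rightarrow> real) \<Rightarrow>
   ('n \<Rightarrow> 'n \<Rightarrow> real \<Rightarrow> real) \<Rightarrow> bool" where
  "assumption_A d a g f \<tau> K I dl G F Kb \<longleftrightarrow>
     (\<forall>j. mono (g j) \<and> G j > 0 \<and> (\<forall>x u. \<bar>g j (x + u) - g j x\<bar> \<le> G j * \<bar>u\<bar>)) \<and>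
     (\<forall>j. F j > 0 \<and> (\<forall>x u. \<bar>f j (x + u) - f j x\<bar> \<le> F j * \<bar>u\<bar>)) \<and>
     (\<forall>i. continuous_on UNIV (d i) \<and> continuous_on UNIV (I i)) \<and>
     (\<forall>i j. continuous_on UNIV (a i j) \<and> continuous_on UNIV (\<tau> i j) \<and> (\<forall>t. \<tau> i j t \<ge> 0)) \<and>
     (\<forall>i. dl i > 0 \<and> (\<forall>t. d i t \<ge> dl i)) \<and>
     (\<forall>i j. (\<forall>s. continuous_on UNIV (\<lambda>t. K i j t s)) \<and> (\<forall>t. ls_integrator (K i j t))) \<and>
     (\<forall>\<epsilon>>0. \<exists>l>0. \<forall>\<alpha>. \<exists>\<omega>\<in>{\<alpha>..\<alpha> + l}. \<forall>i j t.
        \<bar>d i (t + \<omega>) - d i t\<bar> < \<epsilon> \<and>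
        \<bar>a i j (t + \<omega>) - a i j t\<bar> < \<epsilon> \<and>
        \<bar>I i (t + \<omega>) - I i t\<bar> < \<epsilon> \<and>
        \<bar>\<tau> i j (t + \<omega>) - \<tau> i j t\<bar> < \<epsilon> \<and>
        emeasure (ls_abs (\<lambda>s. K i j (t + \<omega>) s - K i j t s)) {0..} < ennreal \<epsilon>) \<and>
     (\<forall>i j. ls_integrator (Kb i j) \<and>
        (\<forall>t. \<forall>A\<in>sets borel. emeasure (ls_abs (K i j t)) A \<le> emeasure (ls_abs (Kb i j)) A)) \<and>
     (\<exists>\<epsilon>>0. \<forall>i j. set_integrable (ls_abs (Kb i j)) {0..} (\<lambda>s. exp (\<epsilon> * s))) \<and>
     (\<forall>i j. emeasure (ls_abs (Kb i j)) {..<0} = 0)"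

definition solves_at ::
  "('n::finite \<Rightarrow> real \<Rightarrow> real) \<Rightarrow> ('n \<Rightarrow> 'n \<Rightarrow> real \<Rightarrow> real) \<Rightarrow> ('n \<Rightarrow> real \<Rightarrow> real) \<Rightarrow>
   ('n \<Rightarrow> real \<Rightarrow> real) \<Rightarrow> ('n \<Rightarrow> 'n \<Rightarrow> real \<Rightarrow> real) \<Rightarrow> ('n \<Rightarrow> 'n \<Rightarrow> real \<Rightarrow> real \<Rightarrow> real) \<Rightarrow>
   ('n \<Rightarrow> real \<Rightarrow> real) \<Rightarrow> (real \<Rightarrow> real ^ 'n) \<Rightarrow> real \<Rightarrow> bool" where
  "solves_at d a g f \<tau> K I u t \<longleftrightarrow>
     (\<forall>i. (\<forall>j. set_integrable (ls_abs (K i j t)) {0..} (\<lambda>s. f j (u (t - \<tau> i j t - s) $ j))) \<and>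
        ((\<lambda>r. u r $ i) has_real_derivative
           - d i t * u t $ i
           + (\<Sum>j\<in>UNIV. a i j t * g j (u t $ j))
           + (\<Sum>j\<in>UNIV. ls_integral (K i j t) (\<lambda>s. f j (u (t - \<tau> i j t - s) $ j)))
           + I i t) (at t))"

(* The restriction of u to {..0} is the (arbitrary continuous) initial function; it may be
   unbounded, provided the delay integrals converge absolutely. Decay at rate \<beta> can then fail
   (f the identity, K with atoms at very sparse points s_m, and an initial function with bumps
   of height 1/(weight of s_m) near m - s_m), so a rate statement needs an initial function
   with exp (\<beta> s) |u(s)| bounded on {..0}, e.g. a bounded one. *)
definition is_solution ::
  "('n::finite \<Rightarrow> real \<Rightarrow> real) \<Rightarrow> ('n \<Rightarrow> 'n \<Rightarrow> real \<Rightarrow> real) \<Rightarrow> ('n \<Rightarrow> real \<Rightarrow> real) \<Rightarrow>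
   ('n \<Rightarrow> real \<Rightarrow> real) \<Rightarrow> ('n \<Rightarrow> 'n \<Rightarrow> real \<Rightarrow> real) \<Rightarrow> ('n \<Rightarrow> 'n \<Rightarrow> real \<Rightarrow> real \<Rightarrow> real) \<Rightarrow>
   ('n \<Rightarrow> real \<Rightarrow> real) \<Rightarrow> (real \<Rightarrow> real ^ 'n) \<Rightarrow> bool" where
  "is_solution d a g f \<tau> K I u \<longleftrightarrow>
     continuous_on UNIV u \<and> (\<forall>t>0. solves_at d a g f \<tau> K I u t)"

definition almost_periodic :: "(real \<Rightarrow> 'a::real_normed_vector) \<Rightarrow> bool" where
  "almost_periodic x \<longleftrightarrow>
     continuous_on UNIV x \<and>
     (\<forall>\<epsilon>>0. \<exists>l>0. \<forall>\<alpha>. \<exists>\<omega>\<in>{\<alpha>..\<alpha> + l}. \<forall>t. norm (x (t + \<omega>) - x t) < \<epsilon>)"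

definition xi_norm :: "('n::finite \<Rightarrow> real) \<Rightarrow> real ^ 'n \<Rightarrow> real" where
  "xi_norm \<xi> u = (MAX i. \<bar>inverse (\<xi> i) * u $ i\<bar>)"

(* In both conditions the inequality includes that the exponential moments are finite; this
   has to be said, because the Bochner integral of a non-integrable function is 0. *)
definition condition_t ::
  "('n::finite \<Rightarrow> real \<Rightarrow> real) \<Rightarrow> ('n \<Rightarrow> 'n \<Rightarrow> real \<Rightarrow> real) \<Rightarrow> ('n \<Rightarrow> 'n \<Rightarrow> real \<Rightarrow> real) \<Rightarrow>
   ('n \<Rightarrow> 'n \<Rightarrow> real \<Rightarrow> real \<Rightarrow> real) \<Rightarrow> ('n \<Rightarrow> real) \<Rightarrow> ('n \<Rightarrow> real) \<Rightarrow> ('n \<Rightarrow> real) \<Rightarrow> real \<Rightarrow> bool" where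
  "condition_t d a \<tau> K G F \<xi> \<beta> \<longleftrightarrow>
     (\<forall>t>0. \<forall>i.
        (\<forall>j. set_integrable (ls_abs (K i j t)) {0..} (\<lambda>s. exp (\<beta> * s))) \<and>
        - (d i t - \<beta>) * \<xi> i
        + (\<Sum>j\<in>UNIV. \<bar>a i j t\<bar> * G j * \<xi> j)
        + (\<Sum>j\<in>UNIV. F j * \<xi> j * exp (\<beta> * (SUP r. \<tau> i j r)) *
             (LINT s:{0..}|ls_abs (K i j t). exp (\<beta> * s))) < 0)"

definition condition_uniform ::
  "('n::finite \<Rightarrow> real) \<Rightarrow> ('n \<Rightarrow> 'n \<Rightarrow> real \<Rightarrow> real) \<Rightarrow> ('n \<Rightarrow> 'n \<Rightarrow> real \<Rightarrow> real) \<Rightarrow>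
   ('n \<Rightarrow> 'n \<Rightarrow> real \<Rightarrow> real) \<Rightarrow> ('n \<Rightarrow> real) \<Rightarrow> ('n \<Rightarrow> real) \<Rightarrow> ('n \<Rightarrow> real) \<Rightarrow> real \<Rightarrow> bool" where
  "condition_uniform dl a \<tau> Kb G F \<xi> \<beta> \<longleftrightarrow>
     (\<forall>i.
        (\<forall>j. set_integrable (ls_abs (Kb i j)) {0..} (\<lambda>s. exp (\<beta> * s))) \<and>
        - (dl i - \<beta>) * \<xi> i
        + (\<Sum>j\<in>UNIV. (SUP r. \<bar>a i j r\<bar>) * G j * \<xi> j)
        + (\<Sum>j\<in>UNIV. F j * \<xi> j * exp (\<beta> * (SUP r. \<tau> i j r)) *
             (LINT s:{0..}|ls_abs (Kb i j). exp (\<beta> * s))) < 0)"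

end

theory Submission
  imports Defs
begin

text \<open>
  Bounded solutions on the whole line are the fixed points of the operator sending \<open>u\<close> to the
  unique bounded solution \<open>y\<close> of \<open>y\<^sub>i' = - d\<^sub>i y\<^sub>i + h\<^sub>i[u]\<close>, where \<open>h\<^sub>i[u]\<close> collects the other terms of
  the system. Since the condition holds with weight \<open>e\<^sup>\<beta>\<^sup>s \<ge> 1\<close>, it yields
  \<open>\<Sum>\<^sub>j |a\<^sub>i\<^sub>j| G\<^sub>j \<xi>\<^sub>j + \<Sum>\<^sub>j F\<^sub>j \<xi>\<^sub>j \<integral>|dK\<^sub>i\<^sub>j| \<le> (d\<^sub>i - \<beta>) \<xi>\<^sub>i\<close>, first for \<open>t > 0\<close> and then, by almost
  periodicity, for all \<open>t\<close>; so the operator contracts the weighted sup norm by \<open>1 - \<beta> / sup d\<close>.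
  A translate \<open>v(t + \<omega>)\<close> of the fixed point solves a perturbed system, and the same contraction
  estimate shows that a \<open>\<delta>\<close>-almost period of the coefficients is a \<open>C \<delta>\<close>-almost period of \<open>v\<close>.
  The difference of two solutions decays like \<open>e\<^sup>-\<^sup>\<beta>\<^sup>t\<close> by a first-crossing argument. Two almost
  periodic functions whose difference tends to \<open>0\<close> coincide, hence uniqueness.
\<close>

section \<open>Stieltjes measures and additivity in the integrator\<close>

text \<open>A signed measure dK is handled through its integrator: with V the variation function, dK
  = dV - d(V - K) is a difference of positive Stieltjes measures. Facts about such integrals reduce
  to additivity of \<open>interval_measure\<close> in the integrator. It makes the value independent
  of the decomposition, hence linear in K, and this is needed to compare K(t + \<omega>, .) with
  K(t, .). Two obstacles shape the rest. The linear equations for y can only be solved if the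
  forcing is continuous in t, while the kernels are assumed continuous in t merely for each fixed s.
  And the strict inequality of the condition is not uniform in t, so strictness is lost when almost
  periods carry it to t \<le> 0; what survives is the margin \<beta> \<xi>_i, and this margin makes
  the contraction uniform. Strictness itself is used at a single time t0 > 0, in the first-crossing
  argument, where the exponential moments are finite by hypothesis.\<close>

definition stieltjes :: "(real \<Rightarrow> real) \<Rightarrow> bool" where
  "stieltjes F \<longleftrightarrow> mono F \<and> (\<forall>s. continuous (at_right s) F)"

lemma stieltjes_add: "stieltjes F \<Longrightarrow> stieltjes H \<Longrightarrow> stieltjes (\<lambda>s. F s + H s)"
  by (auto simp: stieltjes_def mono_def intro!: add_mono continuous_add)

lemma emeasure_interval_measure_stieltjes:
  assumes "stieltjes F" "a \<le> b"
  shows "emeasure (interval_measure F) {a<..b} = ennreal (F b - F a)"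
  using assms by (intro emeasure_interval_measure_Ioc) (auto simp: stieltjes_def mono_def)

text \<open>Both sides are measures in \<open>A\<close> that agree on the half-open intervals, an
  intersection-stable generator of the Borel sets, and are finite on the exhausting intervals
  \<open>{-n<..n}\<close>. Uniqueness of measures then applies to \<open>M\<close>, the sum of the
  two set functions.\<close>

lemma emeasure_interval_measure_add:
  assumes F: "stieltjes F" and H: "stieltjes H" and A: "A \<in> sets borel"
  shows "emeasure (interval_measure (\<lambda>s. F s + H s)) A
    = emeasure (interval_measure F) A + emeasure (interval_measure H) A"
proof -
  let ?F = "interval_measure F" and ?H = "interval_measure H"
  define M where "M = measure_of UNIV (sets borel) (\<lambda>A. emeasure ?F A + emeasure ?H A)"
  have sets_M: "sets M = sets borel"
    unfolding M_def using sigma_algebra.sets_measure_of_eq[OF sets.sigma_algebra_axioms[of borel]]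
    by simp
  have em: "emeasure M X = emeasure ?F X + emeasure ?H X" if "X \<in> sets borel" for X
    unfolding M_def
  proof (rule emeasure_measure_of_sigma)
    show "sigma_algebra UNIV (sets (borel::real measure))"
      using sets.sigma_algebra_axioms[of borel] by simp
    show "positive (sets borel) (\<lambda>A. emeasure ?F A + emeasure ?H A)"
      by (simp add: positive_def)
    show "countably_additive (sets borel) (\<lambda>A. emeasure ?F A + emeasure ?H A)"
    proof (intro countably_additiveI)
      fix B :: "nat \<Rightarrow> real set"
      assume B: "range B \<subseteq> sets borel" "disjoint_family B" "(\<Union>i. B i) \<in> sets borel"
      have "(\<Sum>i. emeasure ?F (B i) + emeasure ?H (B i))
          = (\<Sum>i. emeasure ?F (B i)) + (\<Sum>i. emeasure ?H (B i))"
        by (simp add: suminf_add)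
      then show "(\<Sum>i. emeasure ?F (B i) + emeasure ?H (B i))
          = emeasure ?F (\<Union>i. B i) + emeasure ?H (\<Union>i. B i)"
        using B by (simp add: suminf_emeasure)
    qed
  qed (rule that)
  have "interval_measure (\<lambda>s. F s + H s) = M"
  proof (rule measure_eqI_generator_eq)
    let ?E = "range (\<lambda>(a::real, b). {a<..b})"
    show "Int_stable ?E"
    proof (rule Int_stableI)
      fix X Y assume "X \<in> ?E" "Y \<in> ?E"
      then obtain a b c e where "X = {a<..b}" "Y = {c<..e}" by auto
      then have "X \<inter> Y = {max a c<..min b e}" by auto
      then show "X \<inter> Y \<in> ?E" by (auto intro: image_eqI[of _ _ "(max a c, min b e)"])
    qed
    show "?E \<subseteq> Pow UNIV" by simp
    have "sets (borel::real measure) = sigma_sets UNIV ?E"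
      by (subst borel_sigma_sets_Ioc) simp
    then show "sets (interval_measure (\<lambda>s. F s + H s)) = sigma_sets UNIV ?E"
      "sets M = sigma_sets UNIV ?E"
      using sets_M by auto
    have Ioc: "emeasure (interval_measure (\<lambda>s. F s + H s)) {a<..b} = emeasure M {a<..b}" for a b
    proof (cases "a \<le> b")
      case True
      then have "F a \<le> F b" "H a \<le> H b" using F H by (auto simp: stieltjes_def mono_def)
      then show ?thesis
        using True F H
        by (simp add: em emeasure_interval_measure_stieltjes stieltjes_add add_diff_add
            del: ennreal_plus add: ennreal_plus[symmetric])
    next
      case False
      then have "{a<..b} = {}" by auto
      then show ?thesis by simp
    qed
    show "emeasure (interval_measure (\<lambda>s. F s + H s)) X = emeasure M X" if "X \<in> ?E" for X
      using that Ioc by auto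
    let ?A = "\<lambda>n::nat. {- real n<..real n}"
    show "range ?A \<subseteq> ?E" by auto
    show "(\<Union>i. ?A i) = UNIV"
    proof -
      have "\<exists>n. x \<in> ?A n" for x
      proof -
        obtain n where "\<bar>x\<bar> < real n" using reals_Archimedean2 by blast
        then show ?thesis by (intro exI[of _ n]) auto
      qed
      then show ?thesis by blast
    qed
    show "emeasure (interval_measure (\<lambda>s. F s + H s)) (?A i) \<noteq> \<infinity>" for i
      using F H by (simp add: emeasure_interval_measure_stieltjes stieltjes_add)
  qed
  then show ?thesis using em[OF A] by simp
qed

lemma nn_integral_interval_measure_add:
  assumes F: "stieltjes F" and H: "stieltjes H" and u: "u \<in> borel_measurable borel"
  shows "(\<integral>\<^sup>+s. u s \<partial>interval_measure (\<lambda>s. F s + H s))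
    = (\<integral>\<^sup>+s. u s \<partial>interval_measure F) + (\<integral>\<^sup>+s. u s \<partial>interval_measure H)"
  using u
proof (induct rule: borel_measurable_induct)
  case (cong f g)
  then have "f = g" by auto
  then show ?case using cong by simp
next
  case (set A)
  then show ?case using emeasure_interval_measure_add[OF F H] by simp
next
  case (mult u c)
  then show ?case by (simp add: nn_integral_cmult measurable_cong_sets[OF sets_interval_measure refl] distrib_left)
next
  case (add u v)
  then show ?case
    by (simp add: nn_integral_add measurable_cong_sets[OF sets_interval_measure refl] algebra_simps)
next
  case (seq U)
  have m: "(\<integral>\<^sup>+s. (SUP i. U i) s \<partial>interval_measure P) = (SUP i. \<integral>\<^sup>+s. U i s \<partial>interval_measure P)" for P
    using seq(1,4) nn_integral_monotone_convergence_SUP[of U "interval_measure P"]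
    by (simp add: measurable_cong_sets[OF sets_interval_measure refl] image_comp)
  have i: "incseq (\<lambda>i. \<integral>\<^sup>+s. U i s \<partial>interval_measure P)" for P
    using seq(4) by (auto simp: incseq_def le_fun_def intro!: nn_integral_mono)
  show ?case
    unfolding m seq(3) using ennreal_SUP_add[OF i i] by simp
qed

lemma integral_interval_measure_add:
  fixes h :: "real \<Rightarrow> real"
  assumes F: "stieltjes F" and H: "stieltjes H"
    and "integrable (interval_measure F) h" "integrable (interval_measure H) h"
  shows "integrable (interval_measure (\<lambda>s. F s + H s)) h"
    and "(LINT s|interval_measure (\<lambda>s. F s + H s). h s)
      = (LINT s|interval_measure F. h s) + (LINT s|interval_measure H. h s)"
proof -
  have m: "h \<in> borel_measurable borel"
    using borel_measurable_integrable[OF assms(3)] by simp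
  then have mm: "(\<lambda>s. ennreal (h s)) \<in> borel_measurable borel" "(\<lambda>s. ennreal (- h s)) \<in> borel_measurable borel"
    "(\<lambda>s. ennreal (norm (h s))) \<in> borel_measurable borel"
    by measurable
  note add = mm[THEN nn_integral_interval_measure_add[OF F H]]
  show 1: "integrable (interval_measure (\<lambda>s. F s + H s)) h"
    using assms(3,4) m add(3) by (simp add: integrable_iff_bounded)
  have fin: "(\<integral>\<^sup>+s. ennreal (h s) \<partial>interval_measure P) \<noteq> \<infinity>"
    "(\<integral>\<^sup>+s. ennreal (- h s) \<partial>interval_measure P) \<noteq> \<infinity>"
    if "integrable (interval_measure P) h" for P
    using that by (simp_all add: real_integrable_def)
  show "(LINT s|interval_measure (\<lambda>s. F s + H s). h s)
      = (LINT s|interval_measure F. h s) + (LINT s|interval_measure H. h s)"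
    using 1 assms(3,4) fin[OF assms(3)] fin[OF assms(4)]
    by (simp add: real_lebesgue_integral_def add enn2real_plus top.not_eq_extremum)
qed

text \<open>\<open>G\<close> is \<open>F\<close> plus the distribution function
  \<open>G - F\<close>, whose measure adds a nonnegative amount.\<close>

lemma interval_measure_mono:
  assumes "stieltjes F" "stieltjes G" "mono (\<lambda>s. G s - F s)" "A \<in> sets borel"
  shows "emeasure (interval_measure F) A \<le> emeasure (interval_measure G) A"
proof -
  have "stieltjes (\<lambda>s. G s - F s)"
    using assms by (auto simp: stieltjes_def intro!: continuous_diff)
  from emeasure_interval_measure_add[OF assms(1) this assms(4)] show ?thesis by simp
qed

lemma integral_measure_mono:
  fixes h :: "'a \<Rightarrow> real"
  assumes sets: "sets M = sets N" and le: "\<And>A. A \<in> sets N \<Longrightarrow> emeasure M A \<le> emeasure N A"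
    and h: "integrable N h"
  shows "integrable M h" and "(\<And>x. 0 \<le> h x) \<Longrightarrow> integral\<^sup>L M h \<le> integral\<^sup>L N h"
proof -
  \<comment> \<open>The order on measures compares all sets; outside the sigma-algebra both sides
    are 0.\<close>
  have "emeasure M A \<le> emeasure N A" for A
    using sets le by (cases "A \<in> sets N") (auto simp: emeasure_notin_sets)
  then have "M \<le> N"
    using sets by (auto simp: le_measure le_fun_def)
  then have nn: "(\<integral>\<^sup>+x. u x \<partial>M) \<le> (\<integral>\<^sup>+x. u x \<partial>N)" for u
    using nn_integral_mono_measure[OF sets] by blast
  show 1: "integrable M h"
    using h nn[of "\<lambda>x. ennreal (norm (h x))"] sets
    by (auto simp: integrable_iff_bounded cong: measurable_cong_sets)
  show "integral\<^sup>L M h \<le> integral\<^sup>L N h" if "\<And>x. 0 \<le> h x"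
    using that nn[of "\<lambda>x. ennreal (h x)"] 1 h
    by (simp add: nn_integral_eq_integral)
qed

section \<open>Total variation\<close>

definition locally_bv :: "(real \<Rightarrow> real) \<Rightarrow> bool" where
  "locally_bv k \<longleftrightarrow> (\<forall>a b. a \<le> b \<longrightarrow> bdd_above (variation_sums k a b))"

lemma abs_diff_in_variation_sums: "a \<le> b \<Longrightarrow> \<bar>k b - k a\<bar> \<in> variation_sums k a b"
  unfolding variation_sums_def
  by (rule CollectI, rule exI[of _ "\<lambda>m. if m = 0 then a else b"], rule exI[of _ 1])
     (auto simp: incseq_def)

lemma abs_diff_le_variation:
  assumes "locally_bv k" "a \<le> b" shows "\<bar>k b - k a\<bar> \<le> variation k a b"
  using assms abs_diff_in_variation_sums[of a b k] unfolding variation_def locally_bv_def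
  by (intro cSup_upper) auto

lemma variation_le:
  assumes "a \<le> b"
    and "\<And>x N. incseq x \<Longrightarrow> x 0 = a \<Longrightarrow> x N = b \<Longrightarrow> (\<Sum>m<N. \<bar>k (x (Suc m)) - k (x m)\<bar>) \<le> c"
  shows "variation k a b \<le> c"
  unfolding variation_def using abs_diff_in_variation_sums[OF assms(1), of k] assms(2)
  by (intro cSup_least) (auto simp: variation_sums_def)

lemma variation_ge:
  fixes x :: "nat \<Rightarrow> real"
  assumes "locally_bv k" "incseq x" "x 0 = a" "x N = b"
  shows "(\<Sum>m<N. \<bar>k (x (Suc m)) - k (x m)\<bar>) \<le> variation k a b"
proof -
  have "a \<le> b" using assms(2-4) by (metis incseqD le0)
  then show ?thesis using assms unfolding variation_def locally_bv_def
    by (intro cSup_upper) (auto simp: variation_sums_def)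
qed

lemma variation_exists:
  assumes "a \<le> b" "c < variation k a b"
  obtains x N where "incseq x" "x 0 = a" "x N = b" "c < (\<Sum>m<N. \<bar>k (x (Suc m)) - k (x m)\<bar>)"
proof (rule ccontr)
  assume "\<not> thesis"
  with that have "\<not> c < (\<Sum>m<N. \<bar>k (x (Suc m)) - k (x m)\<bar>)"
    if "incseq x" "x 0 = a" "x N = b" for x N using that by blast
  then have "variation k a b \<le> c"
    by (intro variation_le[OF assms(1)]) (simp add: not_less)
  then show False using assms(2) by simp
qed

text \<open>Cutting a partition at \<open>b\<close> by \<open>min\<close> and \<open>max\<close> keeps it a sequence with the same index
  range, because \<open>k (min x b) + k (max x b) = k x + k b\<close>.\<close>

lemma partition_split:
  fixes x :: "nat \<Rightarrow> real" and k :: "real \<Rightarrow> real"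
  shows "(\<Sum>m<N. \<bar>k (x (Suc m)) - k (x m)\<bar>)
    \<le> (\<Sum>m<N. \<bar>k (min (x (Suc m)) b) - k (min (x m) b)\<bar>)
      + (\<Sum>m<N. \<bar>k (max (x (Suc m)) b) - k (max (x m) b)\<bar>)"
  unfolding sum.distrib[symmetric]
proof (rule sum_mono)
  fix m
  have e: "k (min y b) + k (max y b) = k y + k b" for y :: real
    by (auto simp: min_def max_def)
  show "\<bar>k (x (Suc m)) - k (x m)\<bar>
    \<le> \<bar>k (min (x (Suc m)) b) - k (min (x m) b)\<bar> + \<bar>k (max (x (Suc m)) b) - k (max (x m) b)\<bar>"
    using e[of "x m"] e[of "x (Suc m)"] by linarith
qed

lemma incseq_min_max:
  fixes x :: "nat \<Rightarrow> real"
  assumes "incseq x"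
  shows "incseq (\<lambda>m. min (x m) b)" "incseq (\<lambda>m. max (x m) b)"
  using assms unfolding incseq_def by (auto intro: min.coboundedI1 max.coboundedI1)

text \<open>For \<le>, a partition of [a, c] is cut at b. For \<ge>, partitions of [a, b] and [b, c]
  are concatenated, and the two suprema are taken one after the other.\<close>

lemma variation_add:
  assumes k: "locally_bv k" and ab: "a \<le> b" and bc: "b \<le> c"
  shows "variation k a c = variation k a b + variation k b c"
proof (rule antisym)
  show "variation k a c \<le> variation k a b + variation k b c"
  proof (rule variation_le)
    fix x :: "nat \<Rightarrow> real" and N assume x: "incseq x" "x 0 = a" "x N = c"
    have "(\<Sum>m<N. \<bar>k (min (x (Suc m)) b) - k (min (x m) b)\<bar>) \<le> variation k a b"
      using x ab bc by (intro variation_ge[OF k incseq_min_max(1)]) auto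
    moreover have "(\<Sum>m<N. \<bar>k (max (x (Suc m)) b) - k (max (x m) b)\<bar>) \<le> variation k b c"
      using x ab bc by (intro variation_ge[OF k incseq_min_max(2)]) auto
    ultimately show "(\<Sum>m<N. \<bar>k (x (Suc m)) - k (x m)\<bar>) \<le> variation k a b + variation k b c"
      using partition_split[of k x N b] by linarith
  qed (use ab bc in simp)
  have "(\<Sum>m<N. \<bar>k (x (Suc m)) - k (x m)\<bar>) + (\<Sum>m<N'. \<bar>k (y (Suc m)) - k (y m)\<bar>) \<le> variation k a c"
    if x: "incseq x" "x 0 = a" "x N = b" and y: "incseq y" "y 0 = b" "y N' = c" for x y N N'
  proof -
    \<comment> \<open>The pieces share the point b = \<open>x N\<close> = \<open>y 0\<close>, so
      \<open>z (N + m) = y m\<close> holds for \<open>m = 0\<close> as well.\<close>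
    define z where "z m = (if m \<le> N then x m else y (m - N))" for m
    have "incseq z"
    proof (rule incseq_SucI)
      fix m
      consider "Suc m \<le> N" | "m = N" | "N < m" by linarith
      then show "z m \<le> z (Suc m)"
        using x y incseqD[OF y(1), of 0 1] incseqD[OF y(1), of "m - N" "Suc m - N"]
        by cases (auto simp: z_def incseq_SucD)
    qed
    moreover have "z 0 = a" "z (N + N') = c" using x y by (auto simp: z_def)
    moreover have "(\<Sum>m<N + N'. \<bar>k (z (Suc m)) - k (z m)\<bar>)
      = (\<Sum>m<N. \<bar>k (x (Suc m)) - k (x m)\<bar>) + (\<Sum>m<N'. \<bar>k (y (Suc m)) - k (y m)\<bar>)"
    proof -
      have "(\<Sum>m<N + N'. \<bar>k (z (Suc m)) - k (z m)\<bar>)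
        = (\<Sum>m<N. \<bar>k (z (Suc m)) - k (z m)\<bar>) + (\<Sum>m<N'. \<bar>k (z (Suc (N + m))) - k (z (N + m))\<bar>)"
        by (induction N') auto
      moreover have "z (N + m) = y m" for m using x y by (auto simp: z_def)
      then have "z (Suc (N + m)) = y (Suc m)" "z (N + m) = y m" for m
        by (metis add_Suc_right)+
      ultimately show ?thesis by (simp add: z_def)
    qed
    ultimately show ?thesis using variation_ge[OF k, of z a "N + N'" c] by simp
  qed
  note both = this
  have tail: "variation k b c \<le> variation k a c - (\<Sum>m<N. \<bar>k (x (Suc m)) - k (x m)\<bar>)"
    if x: "incseq x" "x 0 = a" "x N = b" for x N
  proof (rule variation_le[OF bc])
    fix y :: "nat \<Rightarrow> real" and N' assume y: "incseq y" "y 0 = b" "y N' = c"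
    show "(\<Sum>m<N'. \<bar>k (y (Suc m)) - k (y m)\<bar>) \<le> variation k a c - (\<Sum>m<N. \<bar>k (x (Suc m)) - k (x m)\<bar>)"
      using both[OF x y] by linarith
  qed
  have "variation k a b \<le> variation k a c - variation k b c"
  proof (rule variation_le[OF ab])
    fix x :: "nat \<Rightarrow> real" and N assume x: "incseq x" "x 0 = a" "x N = b"
    show "(\<Sum>m<N. \<bar>k (x (Suc m)) - k (x m)\<bar>) \<le> variation k a c - variation k b c"
      using tail[OF x] by linarith
  qed
  then show "variation k a b + variation k b c \<le> variation k a c" by simp
qed

lemma variation_fun_diff:
  assumes k: "locally_bv k" and "a \<le> b"
  shows "variation_fun k b - variation_fun k a = variation k a b"
proof -
  consider "0 \<le> a" | "a < 0" "0 \<le> b" | "b < 0" by linarith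
  then show ?thesis
  proof cases
    case 1
    then show ?thesis using variation_add[OF k 1 assms(2)] assms(2) by (simp add: variation_fun_def)
  next
    case 2
    then show ?thesis using variation_add[OF k, of a 0 b] by (simp add: variation_fun_def)
  next
    case 3
    then show ?thesis using variation_add[OF k assms(2), of 0] assms(2) by (simp add: variation_fun_def)
  qed
qed

lemma abs_diff_le_variation_fun:
  assumes "locally_bv k" "a \<le> b"
  shows "\<bar>k b - k a\<bar> \<le> variation_fun k b - variation_fun k a"
  using abs_diff_le_variation[OF assms] variation_fun_diff[OF assms] by simp

lemma mono_variation_fun:
  assumes k: "locally_bv k"
  shows "mono (variation_fun k)" "mono (\<lambda>s. variation_fun k s - k s)"
    "mono (\<lambda>s. variation_fun k s + k s)"
proof -
  have "\<bar>k b - k a\<bar> \<le> variation_fun k b - variation_fun k a" if "a \<le> b" for a b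
    using abs_diff_le_variation_fun[OF k that] .
  then have "variation_fun k a \<le> variation_fun k b"
    "variation_fun k a - k a \<le> variation_fun k b - k b"
    "variation_fun k a + k a \<le> variation_fun k b + k b" if "a \<le> b" for a b
    using that by (smt (verit))+
  then show "mono (variation_fun k)" "mono (\<lambda>s. variation_fun k s - k s)"
    "mono (\<lambda>s. variation_fun k s + k s)"
    by (auto intro!: monoI)
qed

text \<open>The increments of \<open>F\<close> telescope along a partition and so bound every
  variation sum: up to constants, the variation function is the least function whose increments
  dominate those of \<open>k\<close>.\<close>

lemma variation_fun_le:
  assumes k: "locally_bv k" and F: "\<And>a b. a \<le> b \<Longrightarrow> \<bar>k b - k a\<bar> \<le> F b - F a" and ab: "a \<le> b"
  shows "variation_fun k b - variation_fun k a \<le> F b - F a"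
  unfolding variation_fun_diff[OF k ab]
proof (rule variation_le[OF ab])
  fix x :: "nat \<Rightarrow> real" and N assume x: "incseq x" "x 0 = a" "x N = b"
  have "(\<Sum>m<N. \<bar>k (x (Suc m)) - k (x m)\<bar>) \<le> (\<Sum>m<N. F (x (Suc m)) - F (x m))"
    using x(1) by (intro sum_mono F) (auto dest: incseq_SucD)
  also have "\<dots> = F b - F a" using x sum_lessThan_telescope[of "\<lambda>m. F (x m)" N] by simp
  finally show "(\<Sum>m<N. \<bar>k (x (Suc m)) - k (x m)\<bar>) \<le> F b - F a" .
qed

lemma locally_bvI:
  assumes F: "\<And>a b. a \<le> b \<Longrightarrow> \<bar>k b - k a\<bar> \<le> F b - F a"
  shows "locally_bv k"
  unfolding locally_bv_def
proof (intro allI impI bdd_aboveI)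
  fix a b s :: real assume "a \<le> b" "s \<in> variation_sums k a b"
  then obtain x :: "nat \<Rightarrow> real" and N where s: "s = (\<Sum>m<N. \<bar>k (x (Suc m)) - k (x m)\<bar>)"
    and x: "incseq x" "x 0 = a" "x N = b" by (auto simp: variation_sums_def)
  have "s \<le> (\<Sum>m<N. F (x (Suc m)) - F (x m))"
    unfolding s using x(1) by (intro sum_mono F) (auto dest: incseq_SucD)
  also have "\<dots> = F b - F a" using x sum_lessThan_telescope[of "\<lambda>m. F (x m)" N] by simp
  finally show "s \<le> F b - F a" .
qed

text \<open>A partition that almost attains the variation over [s, s + 1] is cut at y. As y
  decreases to s, right-continuity makes the finitely many terms below y vanish, so nearly all of
  the variation lies on [y, s + 1], and additivity leaves little for [s, y].\<close>

lemma variation_tendsto_0: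
  assumes k: "locally_bv k" and rc: "continuous (at_right s) k"
  shows "((\<lambda>y. variation k s y) \<longlongrightarrow> 0) (at_right s)"
proof (rule tendstoI)
  fix \<epsilon> :: real assume "\<epsilon> > 0"
  then have "variation k s (s + 1) - \<epsilon> / 2 < variation k s (s + 1)" by simp
  then obtain x N where x: "incseq x" "x 0 = s" "x N = s + 1"
    and big: "variation k s (s + 1) - \<epsilon> / 2 < (\<Sum>m<N. \<bar>k (x (Suc m)) - k (x m)\<bar>)"
    by (rule variation_exists[rotated]) auto
  have xs: "s \<le> x m" for m using incseqD[OF x(1), of 0 m] x(2) by simp
  \<comment> \<open>The point \<open>min (x m) y\<close> is s if \<open>x m = s\<close>, and
    eventually y otherwise.\<close>
  have lim: "((\<lambda>y. k (min (x m) y)) \<longlongrightarrow> k s) (at_right s)" for m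
  proof (cases "x m = s")
    case True
    have "eventually (\<lambda>y. k (min (x m) y) = k s) (at_right s)"
      using eventually_at_right_less[of s] by eventually_elim (simp add: True min_def)
    then show ?thesis by (rule tendsto_eventually)
  next
    case False
    then have "s < x m" using xs[of m] by simp
    then have "eventually (\<lambda>y. y < x m) (at_right s)"
      using eventually_at_right_real[of s "x m"] by (auto elim!: eventually_mono)
    then have "eventually (\<lambda>y. k y = k (min (x m) y)) (at_right s)"
      by eventually_elim (simp add: min_def)
    moreover have "(k \<longlongrightarrow> k s) (at_right s)" using rc unfolding continuous_within .
    ultimately show ?thesis using Lim_transform_eventually by fast
  qed
  have "((\<lambda>y. \<Sum>m<N. \<bar>k (min (x (Suc m)) y) - k (min (x m) y)\<bar>) \<longlongrightarrow> (\<Sum>m<N. \<bar>k s - k s\<bar>)) (at_right s)"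
    by (rule tendsto_sum, rule tendsto_rabs, rule tendsto_diff) (rule lim)+
  then have "eventually (\<lambda>y. (\<Sum>m<N. \<bar>k (min (x (Suc m)) y) - k (min (x m) y)\<bar>) < \<epsilon> / 2) (at_right s)"
    using \<open>\<epsilon> > 0\<close> by (intro order_tendstoD) auto
  moreover have "eventually (\<lambda>y. y \<in> {s<..<s + 1}) (at_right s)"
    by (rule eventually_at_right_real) simp
  ultimately show "eventually (\<lambda>y. dist (variation k s y) 0 < \<epsilon>) (at_right s)"
  proof eventually_elim
    case (elim y)
    have "(\<Sum>m<N. \<bar>k (max (x (Suc m)) y) - k (max (x m) y)\<bar>) \<le> variation k y (s + 1)"
      using x elim by (intro variation_ge[OF k incseq_min_max(2)]) auto
    then have "variation k s y < \<epsilon>"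
      using big elim partition_split[of k x N y] variation_add[OF k, of s y "s + 1"] by auto
    moreover have "0 \<le> variation k s y"
      using abs_diff_le_variation[OF k, of s y] elim by auto
    ultimately show ?case by (simp add: dist_real_def)
  qed
qed

lemma ls_integrator_bv: "ls_integrator k \<Longrightarrow> locally_bv k"
  by (simp add: ls_integrator_def locally_bv_def)

text \<open>The first two functions are the integrators in \<open>ls_integral\<close>. The third
  serves to compare \<open>V - k\<close> with \<open>2 V\<close>, since
  \<open>2 V - (V - k) = V + k\<close>.\<close>

lemma stieltjes_variation_fun:
  assumes "ls_integrator k"
  shows "stieltjes (variation_fun k)" "stieltjes (\<lambda>s. variation_fun k s - k s)"
    "stieltjes (\<lambda>s. variation_fun k s + k s)"
proof -
  have k: "locally_bv k" and rc: "continuous (at_right s) k" for s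
    using assms by (auto simp: ls_integrator_def locally_bv_def)
  have V: "continuous (at_right s) (variation_fun k)" for s
  proof -
    have "eventually (\<lambda>y. variation_fun k s + variation k s y = variation_fun k y) (at_right s)"
      using eventually_at_right_less[of s]
    proof eventually_elim
      case (elim y)
      then show ?case using variation_fun_diff[OF k, of s y] by simp
    qed
    moreover have "((\<lambda>y. variation_fun k s + variation k s y) \<longlongrightarrow> variation_fun k s + 0) (at_right s)"
      by (intro tendsto_intros variation_tendsto_0[OF k rc])
    ultimately show ?thesis
      unfolding continuous_within by (auto intro: Lim_transform_eventually)
  qed
  show "stieltjes (variation_fun k)" "stieltjes (\<lambda>s. variation_fun k s - k s)"
    "stieltjes (\<lambda>s. variation_fun k s + k s)"
    using V rc mono_variation_fun[OF k] by (auto simp: stieltjes_def intro!: continuous_intros)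
qed

lemma stieltjes_diff_ls_integrator:
  assumes "stieltjes F" "stieltjes H"
  shows "ls_integrator (\<lambda>s. F s - H s)"
proof -
  have "locally_bv (\<lambda>s. F s - H s)"
  proof (rule locally_bvI[where F = "\<lambda>s. F s + H s"])
    fix a b :: real assume "a \<le> b"
    then have "F a \<le> F b" "H a \<le> H b" using assms by (auto simp: stieltjes_def mono_def)
    then show "\<bar>F b - H b - (F a - H a)\<bar> \<le> F b + H b - (F a + H a)" by linarith
  qed
  then show ?thesis
    using assms by (auto simp: ls_integrator_def locally_bv_def stieltjes_def intro!: continuous_diff)
qed

lemma ls_integrator_diff:
  assumes "ls_integrator k" "ls_integrator l"
  shows "ls_integrator (\<lambda>s. k s - l s)"
proof -
  let ?V = "variation_fun k" and ?W = "variation_fun l"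
  have "ls_integrator (\<lambda>s. (?V s + (?W s - l s)) - (?W s + (?V s - k s)))"
    using assms by (intro stieltjes_diff_ls_integrator stieltjes_add stieltjes_variation_fun)
  moreover have "(?V s + (?W s - l s)) - (?W s + (?V s - k s)) = k s - l s" for s by simp
  ultimately show ?thesis by simp
qed

section \<open>The signed Stieltjes integral\<close>

lemma sets_ls_abs [simp, measurable_cong]: "sets (ls_abs k) = sets borel"
  by (simp add: ls_abs_def)

lemma space_ls_abs [simp]: "space (ls_abs k) = UNIV"
  by (simp add: ls_abs_def)

lemma ls_abs_le:
  assumes k: "ls_integrator k" and F: "stieltjes F"
    and le: "\<And>a b. a \<le> b \<Longrightarrow> \<bar>k b - k a\<bar> \<le> F b - F a" and A: "A \<in> sets borel"
  shows "emeasure (ls_abs k) A \<le> emeasure (interval_measure F) A"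
  unfolding ls_abs_def
proof (rule interval_measure_mono[OF stieltjes_variation_fun(1)[OF k] F _ A])
  show "mono (\<lambda>s. F s - variation_fun k s)"
    using variation_fun_le[OF ls_integrator_bv[OF k] le] by (intro monoI) (simp add: algebra_simps)
qed

text \<open>The variation functions of \<open>l\<close> and \<open>k - l\<close> together dominate
  the increments of \<open>k\<close>, so minimality of the variation applies. It is used to compare
  the masses of a kernel at times that differ by an almost period.\<close>

lemma ls_abs_triangle:
  assumes k: "ls_integrator k" and l: "ls_integrator l" and A: "A \<in> sets borel"
  shows "emeasure (ls_abs k) A \<le> emeasure (ls_abs l) A + emeasure (ls_abs (\<lambda>s. k s - l s)) A"
proof -
  have kl: "ls_integrator (\<lambda>s. k s - l s)" using k l by (rule ls_integrator_diff)
  let ?F = "\<lambda>s. variation_fun l s + variation_fun (\<lambda>s. k s - l s) s"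
  have "emeasure (ls_abs k) A \<le> emeasure (interval_measure ?F) A"
  proof (rule ls_abs_le[OF k _ _ A])
    show "stieltjes ?F" using l kl by (intro stieltjes_add stieltjes_variation_fun)
    fix a b :: real assume "a \<le> b"
    then show "\<bar>k b - k a\<bar> \<le> ?F b - ?F a"
      using abs_diff_le_variation_fun[OF ls_integrator_bv[OF l], of a b]
        abs_diff_le_variation_fun[OF ls_integrator_bv[OF kl], of a b] by linarith
  qed
  also have "\<dots> = emeasure (ls_abs l) A + emeasure (ls_abs (\<lambda>s. k s - l s)) A"
    unfolding ls_abs_def
    using l kl A by (intro emeasure_interval_measure_add stieltjes_variation_fun)
  finally show ?thesis .
qed

text \<open>Since \<open>V + k\<close> is non-decreasing, d(V - k) \<le> 2 dV; this is the origin of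
  the factor 2.\<close>

lemma integrable_variation_minus:
  fixes h :: "real \<Rightarrow> real"
  assumes k: "ls_integrator k" and h: "integrable (ls_abs k) h"
  shows "integrable (interval_measure (\<lambda>s. variation_fun k s - k s)) h"
    and "(\<And>s. 0 \<le> h s) \<Longrightarrow>
      (LINT s|interval_measure (\<lambda>s. variation_fun k s - k s). h s) \<le> 2 * (LINT s|ls_abs k. h s)"
proof -
  let ?V = "variation_fun k"
  note V = stieltjes_variation_fun[OF k]
  have h2: "integrable (interval_measure (\<lambda>s. ?V s + ?V s)) h"
    "(LINT s|interval_measure (\<lambda>s. ?V s + ?V s). h s) = 2 * (LINT s|ls_abs k. h s)"
    using integral_interval_measure_add[OF V(1) V(1), of h] h by (simp_all add: ls_abs_def)
  have le: "emeasure (interval_measure (\<lambda>s. ?V s - k s)) A \<le> emeasure (interval_measure (\<lambda>s. ?V s + ?V s)) A"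
    if "A \<in> sets borel" for A
  proof (rule interval_measure_mono[OF V(2) stieltjes_add[OF V(1) V(1)] _ that])
    have "?V s + ?V s - (?V s - k s) = ?V s + k s" for s by simp
    then show "mono (\<lambda>s. ?V s + ?V s - (?V s - k s))" using V(3) by (simp add: stieltjes_def)
  qed
  show "integrable (interval_measure (\<lambda>s. ?V s - k s)) h"
    by (rule integral_measure_mono(1)[OF _ _ h2(1)]) (use le in auto)
  show "(LINT s|interval_measure (\<lambda>s. ?V s - k s). h s) \<le> 2 * (LINT s|ls_abs k. h s)"
    if "\<And>s. 0 \<le> h s"
    unfolding h2(2)[symmetric] using le that
    by (intro integral_measure_mono(2)[OF _ _ h2(1)]) auto
qed

lemma set_integrable_variation_minus:
  fixes h :: "real \<Rightarrow> real"
  assumes "ls_integrator k" "set_integrable (ls_abs k) A h"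
  shows "set_integrable (interval_measure (\<lambda>s. variation_fun k s - k s)) A h"
  using integrable_variation_minus(1)[OF assms(1)] assms(2) by (auto simp: set_integrable_def)

lemma ls_integral_diff:
  assumes k: "ls_integrator k"
    and h: "set_integrable (ls_abs k) {0..} h" "set_integrable (ls_abs k) {0..} h'"
  shows "ls_integral k (\<lambda>s. h s - h' s) = ls_integral k h - ls_integral k h'"
  using set_integral_diff(2)[OF h] set_integral_diff(2)[OF h[THEN set_integrable_variation_minus[OF k]]]
  by (simp add: ls_integral_def ls_abs_def)

text \<open>For h \<ge> 0, the bounds 0 \<le> d(V - k) \<le> 2 dV confine the integral of h against
  dk = dV - d(V - k) between minus and plus its integral against dV. The general case splits h into
  positive and negative part.\<close>

lemma abs_ls_integral_le:
  assumes k: "ls_integrator k" and h: "set_integrable (ls_abs k) {0..} h"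
  shows "\<bar>ls_integral k h\<bar> \<le> (LINT s:{0..}|ls_abs k. \<bar>h s\<bar>)"
proof -
  have pos: "\<bar>ls_integral k u\<bar> \<le> (LINT s:{0..}|ls_abs k. u s)"
    if "set_integrable (ls_abs k) {0..} u" "\<And>s. 0 \<le> u s" for u
  proof -
    let ?N = "interval_measure (\<lambda>s. variation_fun k s - k s)"
    let ?u = "\<lambda>s. indicator {0..} s *\<^sub>R u s :: real"
    have nonneg: "0 \<le> ?u s" for s using that(2) by (simp add: indicator_def)
    have "integral\<^sup>L ?N ?u \<le> 2 * integral\<^sup>L (ls_abs k) ?u"
      using that(1) nonneg unfolding set_integrable_def
      by (rule integrable_variation_minus(2)[OF k])
    moreover have "0 \<le> integral\<^sup>L ?N ?u" using nonneg by (simp add: integral_nonneg)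
    ultimately show ?thesis
      unfolding ls_integral_def ls_abs_def set_lebesgue_integral_def by linarith
  qed
  let ?p = "\<lambda>s. max 0 (h s)" and ?m = "\<lambda>s. max 0 (- h s)"
  have abs: "set_integrable (ls_abs k) {0..} (\<lambda>s. \<bar>h s\<bar>)"
    using h by (rule set_integrable_abs)
  have p_eq: "?p = (\<lambda>s. (1/2) * (\<bar>h s\<bar> + h s))" and m_eq: "?m = (\<lambda>s. (1/2) * (\<bar>h s\<bar> - h s))"
    by auto
  have p: "set_integrable (ls_abs k) {0..} ?p" unfolding p_eq
    by (intro set_integrable_mult_right set_integral_add(1) abs h)
  have m: "set_integrable (ls_abs k) {0..} ?m" unfolding m_eq
    by (intro set_integrable_mult_right set_integral_diff(1) abs h)
  have "(\<lambda>s. ?p s - ?m s) = h" by auto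
  then have "ls_integral k h = ls_integral k ?p - ls_integral k ?m"
    using ls_integral_diff[OF k p m] by simp
  moreover have "(\<lambda>s. \<bar>h s\<bar>) = (\<lambda>s. ?p s + ?m s)" by auto
  then have "(LINT s:{0..}|ls_abs k. \<bar>h s\<bar>) = (LINT s:{0..}|ls_abs k. ?p s) + (LINT s:{0..}|ls_abs k. ?m s)"
    using set_integral_add(2)[OF p m] by simp
  ultimately show ?thesis using pos[OF p] pos[OF m] by (simp add: abs_le_iff)
qed

text \<open>Any decomposition of \<open>k\<close> as a difference of distribution functions computes the same
  integral, since \<open>V + H = F + (V - k)\<close>.\<close>

lemma ls_integral_eq:
  assumes F: "stieltjes F" and H: "stieltjes H" and k: "k = (\<lambda>s. F s - H s)"
    and hF: "set_integrable (interval_measure F) {0..} h"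
    and hH: "set_integrable (interval_measure H) {0..} h"
  shows "ls_integral k h
    = (LINT s:{0..}|interval_measure F. h s) - (LINT s:{0..}|interval_measure H. h s)"
proof -
  have int: "ls_integrator k" unfolding k using F H by (rule stieltjes_diff_ls_integrator)
  note V = stieltjes_variation_fun[OF int]
  let ?V = "variation_fun k"
  let ?h = "\<lambda>s. indicator {0..} s *\<^sub>R h s :: real"
  note h = hF[unfolded set_integrable_def] hH[unfolded set_integrable_def]
  \<comment> \<open>Integrability against |dk| is derived: \<open>F + H\<close> dominates the
    variation of \<open>F - H\<close>.\<close>
  have "emeasure (ls_abs k) A \<le> emeasure (interval_measure (\<lambda>s. F s + H s)) A"
    if "A \<in> sets borel" for A
  proof (rule ls_abs_le[OF int stieltjes_add[OF F H] _ that])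
    fix a b :: real assume "a \<le> b"
    then have "F a \<le> F b" "H a \<le> H b" using F H by (auto simp: stieltjes_def mono_def)
    then show "\<bar>k b - k a\<bar> \<le> F b + H b - (F a + H a)" unfolding k by linarith
  qed
  then have hV: "integrable (ls_abs k) ?h"
    by (intro integral_measure_mono(1)[OF _ _ integral_interval_measure_add(1)[OF F H h]]) auto
  note hVk = integrable_variation_minus(1)[OF int hV]
  have "(\<lambda>s. ?V s + H s) = (\<lambda>s. F s + (?V s - k s))" unfolding k by auto
  then have "integral\<^sup>L (ls_abs k) ?h + integral\<^sup>L (interval_measure H) ?h
    = integral\<^sup>L (interval_measure F) ?h + integral\<^sup>L (interval_measure (\<lambda>s. ?V s - k s)) ?h"
    using integral_interval_measure_add(2)[OF V(1) H, of ?h] h hV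
      integral_interval_measure_add(2)[OF F V(2), of ?h] hVk unfolding ls_abs_def by simp
  then show ?thesis
    unfolding ls_integral_def set_lebesgue_integral_def ls_abs_def by linarith
qed

text \<open>The crossed decomposition k - l = (V + (W - l)) - (W + (V - k)) need not be the one
  given by the variation of k - l, but \<open>ls_integral_eq\<close> accepts any decomposition, and
  additivity in the integrator then separates the two integrals.\<close>

lemma ls_integral_integrator_diff:
  assumes k: "ls_integrator k" and l: "ls_integrator l"
    and hk: "set_integrable (ls_abs k) {0..} h" and hl: "set_integrable (ls_abs l) {0..} h"
  shows "ls_integral (\<lambda>s. k s - l s) h = ls_integral k h - ls_integral l h"
proof -
  let ?V = "variation_fun k" and ?W = "variation_fun l"
  note V = stieltjes_variation_fun[OF k] and W = stieltjes_variation_fun[OF l]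
  note hs = hk[unfolded set_integrable_def ls_abs_def] hl[unfolded set_integrable_def ls_abs_def]
    set_integrable_variation_minus[OF k hk, unfolded set_integrable_def]
    set_integrable_variation_minus[OF l hl, unfolded set_integrable_def]
  note a = integral_interval_measure_add[OF V(1) W(2) hs(1) hs(4)]
    and b = integral_interval_measure_add[OF W(1) V(2) hs(2) hs(3)]
  have "ls_integral (\<lambda>s. k s - l s) h
    = (LINT s:{0..}|interval_measure (\<lambda>s. ?V s + (?W s - l s)). h s)
      - (LINT s:{0..}|interval_measure (\<lambda>s. ?W s + (?V s - k s)). h s)"
    by (rule ls_integral_eq[OF stieltjes_add[OF V(1) W(2)] stieltjes_add[OF W(1) V(2)]])
       (use a b in \<open>auto simp: set_integrable_def\<close>)
  then show ?thesis using a(2) b(2) unfolding ls_integral_def set_lebesgue_integral_def by simp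
qed

lemma ls_abs_integral_mono:
  fixes h :: "real \<Rightarrow> real"
  assumes "\<And>A. A \<in> sets borel \<Longrightarrow> emeasure (ls_abs k) A \<le> emeasure (ls_abs l) A"
    and h: "set_integrable (ls_abs l) A h"
  shows "set_integrable (ls_abs k) A h"
    and "(\<And>s. 0 \<le> h s) \<Longrightarrow> (LINT s:A|ls_abs k. h s) \<le> (LINT s:A|ls_abs l. h s)"
  using integral_measure_mono[of "ls_abs k" "ls_abs l" "\<lambda>s. indicator A s *\<^sub>R h s"] assms
  by (auto simp: set_integrable_def set_lebesgue_integral_def indicator_def)

text \<open>For \<open>a < 0\<close> the integral over \<open>{0..}\<close> includes the atom at \<open>0\<close>, so the value is \<open>k b - k a\<close>
  only because there is no mass below \<open>0\<close>.\<close>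

lemma ls_integral_indicator_Ioc:
  assumes k: "ls_integrator k" and null: "emeasure (ls_abs k) {..<0} = 0" and ab: "a \<le> b"
  shows "ls_integral k (indicator {a<..b}) = k b - k a"
proof -
  note V = stieltjes_variation_fun[OF k]
  \<comment> \<open>The inequality d(V - k) \<le> 2 dV carries the null set below 0 over to the
    second measure.\<close>
  have m0: "emeasure (interval_measure (\<lambda>s. variation_fun k s - k s)) {..<0} = 0"
  proof -
    have "emeasure (interval_measure (\<lambda>s. variation_fun k s - k s)) {..<0}
        \<le> emeasure (interval_measure (\<lambda>s. variation_fun k s + variation_fun k s)) {..<0}"
    proof (rule interval_measure_mono[OF V(2) stieltjes_add[OF V(1) V(1)]])
      have "variation_fun k s + variation_fun k s - (variation_fun k s - k s) = variation_fun k s + k s" for s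
        by simp
      then show "mono (\<lambda>s. variation_fun k s + variation_fun k s - (variation_fun k s - k s))"
        using V(3) by (simp add: stieltjes_def)
    qed simp
    also have "\<dots> = 0"
      using emeasure_interval_measure_add[OF V(1) V(1), of "{..<0}"] null by (simp add: ls_abs_def)
    finally show ?thesis by simp
  qed
  have *: "(LINT s:{0..}|interval_measure F. indicator {a<..b} s) = F b - F a"
    if F: "stieltjes F" and F0: "emeasure (interval_measure F) {..<0} = 0" for F
  proof -
    have le: "F a \<le> F b" using F ab by (simp add: stieltjes_def mono_def)
    have "AE s in interval_measure F. s \<notin> {..<0}"
      using F0 by (intro AE_not_in) (simp add: null_sets_def)
    then have "(LINT s:{0..}|interval_measure F. indicator {a<..b} s)
        = (LINT s|interval_measure F. indicator {a<..b} s)"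
      unfolding set_lebesgue_integral_def
      by (intro integral_cong_AE) (auto simp: indicator_def elim!: eventually_mono)
    also have "\<dots> = F b - F a"
      using emeasure_interval_measure_stieltjes[OF F ab] le by (simp add: measure_def)
    finally show ?thesis .
  qed
  show ?thesis
    unfolding ls_integral_def using *[OF V(1)] *[OF V(2) m0] null by (simp add: ls_abs_def)
qed

section \<open>Continuity of the integral in a parameter\<close>

lemma set_integrable_ls_abs_bounded:
  fixes h :: "real \<Rightarrow> real"
  assumes "emeasure (ls_abs k) {0..} < \<infinity>" "h \<in> borel_measurable borel" "\<And>s. \<bar>h s\<bar> \<le> B"
  shows "set_integrable (ls_abs k) {0..} h"
  unfolding set_integrable_def
  using assms by (intro integrableI_bounded_set_indicator[where B = B])
    (auto simp: measurable_cong_sets[OF sets_ls_abs refl])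

lemma abs_ls_integral_le_bound:
  assumes k: "ls_integrator k" and fin: "emeasure (ls_abs k) {0..} < \<infinity>"
    and h: "h \<in> borel_measurable borel" and B: "\<And>s. \<bar>h s\<bar> \<le> B"
  shows "\<bar>ls_integral k h\<bar> \<le> B * measure (ls_abs k) {0..}"
proof -
  have hi: "set_integrable (ls_abs k) {0..} h"
    using fin h B by (rule set_integrable_ls_abs_bounded)
  have ci: "set_integrable (ls_abs k) {0..} (\<lambda>s. B)"
    by (rule set_integrable_ls_abs_bounded[OF fin, of _ "\<bar>B\<bar>"]) auto
  have "\<bar>ls_integral k h\<bar> \<le> (LINT s:{0..}|ls_abs k. \<bar>h s\<bar>)"
    using k hi by (rule abs_ls_integral_le)
  also have "\<dots> \<le> (LINT s:{0..}|ls_abs k. B)"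
    using B by (intro set_integral_mono set_integrable_abs hi ci) auto
  also have "\<dots> = B * measure (ls_abs k) {0..}"
    by (simp add: set_lebesgue_integral_def)
  finally show ?thesis .
qed

lemma ls_integral_sum:
  assumes k: "ls_integrator k" and u: "\<And>m. m \<in> S \<Longrightarrow> set_integrable (ls_abs k) {0..} (u m)"
  shows "ls_integral k (\<lambda>s. \<Sum>m\<in>S. c m * u m s) = (\<Sum>m\<in>S. c m * ls_integral k (u m))"
proof -
  have *: "(LINT s:{0..}|M. (\<Sum>m\<in>S. c m * u m s)) = (\<Sum>m\<in>S. c m * (LINT s:{0..}|M. u m s))"
    if "\<And>m. m \<in> S \<Longrightarrow> set_integrable M {0..} (u m)" for M
  proof -
    have "(LINT s:{0..}|M. (\<Sum>m\<in>S. c m * u m s))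
      = (LINT s|M. (\<Sum>m\<in>S. c m * (indicator {0..} s *\<^sub>R u m s)))"
      unfolding set_lebesgue_integral_def
      by (intro Bochner_Integration.integral_cong) (auto simp: sum_distrib_left algebra_simps)
    also have "\<dots> = (\<Sum>m\<in>S. c m * (LINT s:{0..}|M. u m s))"
      using that unfolding set_lebesgue_integral_def set_integrable_def
      by (subst Bochner_Integration.integral_sum) auto
    finally show ?thesis .
  qed
  show ?thesis
    unfolding ls_integral_def
    using *[OF u[unfolded ls_abs_def]] *[OF set_integrable_variation_minus[OF k u]]
    by (simp add: sum_subtractf algebra_simps)
qed

text \<open>Pointwise continuity of \<open>t \<mapsto> K(t,s)\<close> only gives continuity of the integrals of step functions;
  the domination by \<open>|dK(s)|\<close> makes the passage to continuous integrands uniform in \<open>t\<close>.\<close>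

definition step_approx :: "(real \<Rightarrow> real) \<Rightarrow> nat \<Rightarrow> real \<Rightarrow> real" where
  "step_approx h p s = (\<Sum>m\<in>{- int p..<int p * int p}.
     h ((of_int m + 1) / real p) * indicator {of_int m / real p<..(of_int m + 1) / real p} s)"

text \<open>The cell containing s has the right end \<lceil>s p\<rceil> / p. The cells are open on
  the left, to match the masses k b - k a, and together they fill (-1, p]. The indices start below 0
  so that the cell (-1/p, 0] is present and an atom at 0 is counted.\<close>

lemma step_approx_eq:
  assumes p: "p > 0"
  shows "step_approx h p s
    = (if \<lceil>s * real p\<rceil> - 1 \<in> {- int p..<int p * int p} then h (of_int \<lceil>s * real p\<rceil> / real p) else 0)"
proof -
  have ind: "indicator {of_int m / real p<..(of_int m + 1) / real p} s
      = (if m = \<lceil>s * real p\<rceil> - 1 then 1 else 0 :: real)" for m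
  proof -
    have "of_int m / real p < s \<and> s \<le> (of_int m + 1) / real p
        \<longleftrightarrow> of_int (m + 1) - 1 < s * real p \<and> s * real p \<le> of_int (m + 1)"
      using p by (simp add: field_simps)
    also have "\<dots> \<longleftrightarrow> \<lceil>s * real p\<rceil> = m + 1" by (simp add: ceiling_eq_iff)
    finally show ?thesis by (auto simp: indicator_def)
  qed
  show ?thesis
    unfolding step_approx_def ind by (simp add: if_distrib cong: if_cong)
qed

lemma step_approx_bound:
  assumes "p > 0" and B: "\<And>s. \<bar>h s\<bar> \<le> B"
  shows "\<bar>step_approx h p s\<bar> \<le> B"
proof -
  have "0 \<le> B" using abs_ge_zero[of "h 0"] B[of 0] by linarith
  then show ?thesis using assms by (simp add: step_approx_eq)
qed

lemma step_approx_tendsto: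
  assumes h: "isCont h s" and s: "0 \<le> s"
  shows "(\<lambda>n. step_approx h (Suc n) s) \<longlonglongrightarrow> h s"
proof -
  have lim: "(\<lambda>n. of_int \<lceil>s * real (Suc n)\<rceil> / real (Suc n)) \<longlonglongrightarrow> s"
  proof (rule real_tendsto_sandwich)
    show "eventually (\<lambda>n. s \<le> of_int \<lceil>s * real (Suc n)\<rceil> / real (Suc n)) sequentially"
      by (intro always_eventually allI) (simp add: field_simps del: of_nat_Suc)
    show "eventually (\<lambda>n. of_int \<lceil>s * real (Suc n)\<rceil> / real (Suc n) \<le> s + 1 / real (Suc n)) sequentially"
    proof (intro always_eventually allI)
      fix n
      have "of_int \<lceil>s * real (Suc n)\<rceil> \<le> s * real (Suc n) + 1" by (rule of_int_ceiling_le_add_one)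
      then show "of_int \<lceil>s * real (Suc n)\<rceil> / real (Suc n) \<le> s + 1 / real (Suc n)"
        by (simp add: field_simps del: of_nat_Suc)
    qed
    have "(\<lambda>n. s + 1 / real (Suc n)) \<longlonglongrightarrow> s + 0"
      by (intro tendsto_add tendsto_const LIMSEQ_Suc lim_1_over_n)
    then show "(\<lambda>n. s + 1 / real (Suc n)) \<longlonglongrightarrow> s" by simp
  qed simp
  obtain N where N: "s \<le> real N" using real_arch_simple by blast
  \<comment> \<open>For n \<ge> N the window (-1, n + 1] contains s, so the default value 0 of
    \<open>step_approx_eq\<close> is not taken.\<close>
  have "eventually (\<lambda>n. h (of_int \<lceil>s * real (Suc n)\<rceil> / real (Suc n)) = step_approx h (Suc n) s) sequentially"
    using eventually_ge_at_top[of N]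
  proof eventually_elim
    case (elim n)
    have "s * real (Suc n) \<le> real (Suc n) * real (Suc n)"
      using N elim by (intro mult_right_mono) auto
    then have "\<lceil>s * real (Suc n)\<rceil> \<le> int (Suc n) * int (Suc n)"
      by (simp add: ceiling_le_iff del: of_nat_Suc)
    moreover have "0 \<le> s * real (Suc n)" using s by simp
    then have "0 \<le> \<lceil>s * real (Suc n)\<rceil>" by linarith
    ultimately have "\<lceil>s * real (Suc n)\<rceil> - 1 \<in> {- int (Suc n)..<int (Suc n) * int (Suc n)}"
      unfolding atLeastLessThan_iff by linarith
    then show ?case by (simp only: step_approx_eq[OF zero_less_Suc] if_True)
  qed
  moreover have "(\<lambda>n. h (of_int \<lceil>s * real (Suc n)\<rceil> / real (Suc n))) \<longlonglongrightarrow> h s"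
    using h lim by (rule isCont_tendsto_compose)
  ultimately show ?thesis by (rule Lim_transform_eventually[rotated])
qed

lemma step_approx_measurable [measurable]: "step_approx h p \<in> borel_measurable borel"
  unfolding step_approx_def by measurable

locale ls_family =
  fixes k :: "real \<Rightarrow> real \<Rightarrow> real" and l :: "real \<Rightarrow> real"
  assumes ls: "\<And>t. ls_integrator (k t)"
    and cont: "\<And>s. continuous_on UNIV (\<lambda>t. k t s)"
    and dom: "\<And>t A. A \<in> sets borel \<Longrightarrow> emeasure (ls_abs (k t)) A \<le> emeasure (ls_abs l) A"
    and fin: "emeasure (ls_abs l) {0..} < \<infinity>"
    and null: "emeasure (ls_abs l) {..<0} = 0"
begin

lemma fin': "emeasure (ls_abs (k t)) {0..} < \<infinity>"
  using dom[of "{0..}" t] fin by simp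

lemma null': "emeasure (ls_abs (k t)) {..<0} = 0"
  using dom[of "{..<0}" t] null by simp

lemma measure_le: "measure (ls_abs (k t)) {0..} \<le> measure (ls_abs l) {0..}"
  unfolding measure_def using dom[of "{0..}" t] fin by (intro enn2real_mono) auto

lemma integrable_bounded:
  fixes h :: "real \<Rightarrow> real"
  shows "h \<in> borel_measurable borel \<Longrightarrow> (\<And>s. \<bar>h s\<bar> \<le> B) \<Longrightarrow> set_integrable (ls_abs (k t)) {0..} h"
  by (rule set_integrable_ls_abs_bounded[OF fin'])

text \<open>The right-hand side no longer depends on \<open>t\<close>: one application of dominated
  convergence against |dl| controls the integrals for all \<open>t\<close> at once.\<close>

lemma abs_ls_integral_dom:
  assumes h: "h \<in> borel_measurable borel" "\<And>s. \<bar>h s\<bar> \<le> B"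
  shows "\<bar>ls_integral (k t) h\<bar> \<le> (LINT s:{0..}|ls_abs l. \<bar>h s\<bar>)"
proof -
  have "\<bar>ls_integral (k t) h\<bar> \<le> (LINT s:{0..}|ls_abs (k t). \<bar>h s\<bar>)"
    by (rule abs_ls_integral_le[OF ls integrable_bounded[OF h]])
  also have "\<dots> \<le> (LINT s:{0..}|ls_abs l. \<bar>h s\<bar>)"
    by (rule ls_abs_integral_mono(2)[OF dom set_integrable_abs[OF set_integrable_ls_abs_bounded[OF fin h]]]) auto
  finally show ?thesis .
qed

lemma dominated:
  fixes h :: "nat \<Rightarrow> real \<Rightarrow> real"
  assumes h: "\<And>n. h n \<in> borel_measurable borel" "\<And>n s. \<bar>h n s\<bar> \<le> B"
    and lim: "\<And>s. 0 \<le> s \<Longrightarrow> (\<lambda>n. h n s) \<longlonglongrightarrow> 0"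
  shows "(\<lambda>n. LINT s:{0..}|ls_abs l. \<bar>h n s\<bar>) \<longlonglongrightarrow> 0"
proof -
  have "(\<lambda>n. LINT s|ls_abs l. indicator {0..} s *\<^sub>R \<bar>h n s\<bar>) \<longlonglongrightarrow> (LINT s|ls_abs l. 0)"
  proof (rule integral_dominated_convergence[where w = "\<lambda>s. indicator {0..} s *\<^sub>R B"])
    show "integrable (ls_abs l) (\<lambda>s. indicator {0..} s *\<^sub>R B)"
      using set_integrable_ls_abs_bounded[OF fin, of "\<lambda>_. B" "\<bar>B\<bar>"] by (simp add: set_integrable_def)
    show "AE s in ls_abs l. (\<lambda>n. indicator {0..} s *\<^sub>R \<bar>h n s\<bar>) \<longlonglongrightarrow> 0"
      using lim by (intro AE_I2) (auto simp: indicator_def tendsto_rabs_zero_iff)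
    show "AE s in ls_abs l. norm (indicator {0..} s *\<^sub>R \<bar>h n s\<bar>) \<le> indicator {0..} s *\<^sub>R B" for n
      using h(2) by (intro AE_I2) (auto simp: indicator_def)
  qed (use h(1) in \<open>auto simp: measurable_cong_sets[OF sets_ls_abs refl]\<close>)
  then show ?thesis by (simp add: set_lebesgue_integral_def)
qed

text \<open>A finite combination of values \<open>k t s\<close> at fixed points s; this is where
  continuity of the kernel in \<open>t\<close> for each s enters.\<close>

lemma ls_integral_step_approx:
  "ls_integral (k t) (step_approx h p) = (\<Sum>m\<in>{- int p..<int p * int p}.
     h ((of_int m + 1) / real p) * (k t ((of_int m + 1) / real p) - k t (of_int m / real p)))"
proof -
  have "of_int m / real p \<le> (of_int m + 1) / real p" for m by (simp add: divide_right_mono)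
  note Ioc = ls_integral_indicator_Ioc[OF ls null' this]
  have "set_integrable (ls_abs (k t)) {0..} (indicat_real {of_int m / real p<..(of_int m + 1) / real p})" for m
    by (rule integrable_bounded[where B = 1]) (auto simp: indicator_def)
  then show ?thesis
    unfolding step_approx_def by (subst ls_integral_sum[OF ls]) (simp_all add: Ioc)
qed

lemma continuous_ls_integral_fixed:
  assumes h: "continuous_on UNIV h" and B: "\<And>s. \<bar>h s\<bar> \<le> B"
  shows "continuous_on UNIV (\<lambda>t. ls_integral (k t) h)"
proof (rule uniform_limit_theorem)
  have hm: "h \<in> borel_measurable borel" using h by (rule borel_measurable_continuous_onI)
  let ?d = "\<lambda>n s. step_approx h (Suc n) s - h s"
  have dm: "?d n \<in> borel_measurable borel" for n using hm by measurable
  have dB: "\<bar>?d n s\<bar> \<le> 2 * B" for n s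
    using step_approx_bound[where p = "Suc n" and h = h and B = B and s = s] B B[of s] by fastforce
  have lim: "(\<lambda>n. LINT s:{0..}|ls_abs l. \<bar>?d n s\<bar>) \<longlonglongrightarrow> 0"
  proof (rule dominated[OF dm dB])
    fix s :: real assume "0 \<le> s"
    then show "(\<lambda>n. ?d n s) \<longlonglongrightarrow> 0"
      using h step_approx_tendsto[where h = h and s = s] by (simp add: LIM_zero continuous_on_eq_continuous_at)
  qed
  have le: "\<bar>ls_integral (k t) (step_approx h (Suc n)) - ls_integral (k t) h\<bar>
    \<le> (LINT s:{0..}|ls_abs l. \<bar>?d n s\<bar>)" for n t
  proof -
    have "ls_integral (k t) (?d n) = ls_integral (k t) (step_approx h (Suc n)) - ls_integral (k t) h"
      using step_approx_bound[where p = "Suc n" and h = h and B = B] B hm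
      by (intro ls_integral_diff[OF ls] integrable_bounded[where B = B]) auto
    moreover have "\<bar>ls_integral (k t) (?d n)\<bar> \<le> (LINT s:{0..}|ls_abs l. \<bar>?d n s\<bar>)"
      by (rule abs_ls_integral_dom[OF dm dB])
    ultimately show ?thesis by (simp only:)
  qed
  show "uniform_limit UNIV (\<lambda>n t. ls_integral (k t) (step_approx h (Suc n)))
      (\<lambda>t. ls_integral (k t) h) sequentially"
  proof (rule uniform_limitI)
    fix e :: real assume "e > 0"
    with lim have "\<forall>\<^sub>F n in sequentially. (LINT s:{0..}|ls_abs l. \<bar>?d n s\<bar>) < e"
      by (rule order_tendstoD)
    then show "\<forall>\<^sub>F n in sequentially. \<forall>t\<in>UNIV.
        dist (ls_integral (k t) (step_approx h (Suc n))) (ls_integral (k t) h) < e"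
      by eventually_elim (use le in \<open>auto simp: dist_real_def intro: le_less_trans\<close>)
  qed
  show "\<forall>\<^sub>F n in sequentially. continuous_on UNIV (\<lambda>t. ls_integral (k t) (step_approx h (Suc n)))"
    unfolding ls_integral_step_approx by (intro always_eventually allI continuous_intros cont)
qed simp

lemma continuous_ls_integral:
  assumes h: "\<And>t. continuous_on UNIV (h t)" "\<And>s. continuous_on UNIV (\<lambda>t. h t s)"
    and B: "\<And>t s. \<bar>h t s\<bar> \<le> B"
  shows "continuous_on UNIV (\<lambda>t. ls_integral (k t) (h t))"
  unfolding continuous_on_sequentially
proof (intro allI ballI impI, elim conjE)
  fix x :: "nat \<Rightarrow> real" and t assume x: "x \<longlonglongrightarrow> t"
  have hm: "h r \<in> borel_measurable borel" for r using h(1) by (rule borel_measurable_continuous_onI)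
  let ?d = "\<lambda>n s. h (x n) s - h t s"
  have dm: "?d n \<in> borel_measurable borel" for n using hm by measurable
  have dB: "\<bar>?d n s\<bar> \<le> 2 * B" for n s using B[of "x n" s] B[of t s] by linarith
  have "(\<lambda>n. LINT s:{0..}|ls_abs l. \<bar>?d n s\<bar>) \<longlonglongrightarrow> 0"
    using h(2) x by (intro dominated[OF dm dB] LIM_zero)
      (auto simp: continuous_on_eq_continuous_at intro: isCont_tendsto_compose)
  then have "(\<lambda>n. ls_integral (k (x n)) (?d n)) \<longlonglongrightarrow> 0"
  proof (rule Lim_null_comparison[rotated])
    show "\<forall>\<^sub>F n in sequentially. norm (ls_integral (k (x n)) (?d n))
        \<le> (LINT s:{0..}|ls_abs l. \<bar>?d n s\<bar>)"
      unfolding real_norm_def by (intro always_eventually allI abs_ls_integral_dom[OF dm dB])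
  qed
  moreover have "(\<lambda>n. ls_integral (k (x n)) (h t)) \<longlonglongrightarrow> ls_integral (k t) (h t)"
    using continuous_ls_integral_fixed[OF h(1) B] x
    by (auto simp: continuous_on_eq_continuous_at intro: isCont_tendsto_compose)
  ultimately have "(\<lambda>n. ls_integral (k (x n)) (?d n) + ls_integral (k (x n)) (h t))
      \<longlonglongrightarrow> 0 + ls_integral (k t) (h t)"
    by (rule tendsto_add)
  moreover have "ls_integral (k (x n)) (?d n) + ls_integral (k (x n)) (h t)
      = ls_integral (k (x n)) (h (x n))" for n
    by (subst ls_integral_diff[OF ls integrable_bounded[OF hm B] integrable_bounded[OF hm B]]) simp
  ultimately show "((\<lambda>t. ls_integral (k t) (h t)) \<circ> x) \<longlonglongrightarrow> ls_integral (k t) (h t)"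
    by (simp add: comp_def)
qed

end

section \<open>Scalar linear equations and almost periodic functions\<close>

lemma antiderivative_exists:
  fixes f :: "real \<Rightarrow> real"
  assumes "continuous_on UNIV f"
  obtains P where "\<And>t. (P has_real_derivative f t) (at t)"
proof
  fix t :: real
  \<comment> \<open>This choice makes t an interior point, so the derivative within the interval is
    a full derivative.\<close>
  let ?b = "\<bar>t\<bar> + 1"
  have "((\<lambda>u. LBINT y=0..u. f y) has_vector_derivative f t) (at t within {- ?b..?b})"
    using interval_integral_FTC2[of "- ?b" 0 ?b f t] continuous_on_subset[OF assms]
    by (simp add: zero_ereal_def)
  moreover have "at t within {- ?b..?b} = at t" by (rule at_within_interior) auto
  ultimately show "((\<lambda>u. LBINT y=0..u. f y) has_real_derivative f t) (at t)"
    by (simp only: has_real_derivative_iff_has_vector_derivative)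
qed

text \<open>With E' = d, the function (z - c) e^E is non-increasing. A bound on the whole line
  replaces an initial condition: starting n time units earlier multiplies the initial excess by at
  most e^(- dl n), which tends to 0.\<close>

lemma linear_comparison:
  fixes z d r :: "real \<Rightarrow> real"
  assumes z: "\<And>t. (z has_real_derivative - d t * z t + r t) (at t)" and bounded: "\<And>t. z t \<le> B"
    and d: "continuous_on UNIV d" and dl: "dl > 0" "\<And>t. dl \<le> d t"
    and r: "\<And>t. r t \<le> d t * c"
  shows "z t \<le> c"
proof -
  obtain E where E: "\<And>t. (E has_real_derivative d t) (at t)"
    using antiderivative_exists[OF d] by blast
  have antimono: "(z t - c) * exp (E t) \<le> (z s - c) * exp (E s)" if "s \<le> t" for s
  proof (rule DERIV_nonpos_imp_nonincreasing[OF that])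
    fix x :: real
    have "((\<lambda>x. (z x - c) * exp (E x)) has_real_derivative (r x - d x * c) * exp (E x)) (at x)"
      by (auto intro!: derivative_eq_intros z E simp: algebra_simps)
    moreover have "(r x - d x * c) * exp (E x) \<le> 0" using r[of x] by (simp add: mult_nonpos_nonneg)
    ultimately show "\<exists>y. ((\<lambda>x. (z x - c) * exp (E x)) has_real_derivative y) (at x) \<and> y \<le> 0" by blast
  qed
  have growth: "E s - E t \<le> - dl * (t - s)" if "s \<le> t" for s
  proof -
    have "E s - dl * s \<le> E t - dl * t"
    proof (rule DERIV_nonneg_imp_nondecreasing[OF that])
      fix x :: real
      have "((\<lambda>x. E x - dl * x) has_real_derivative d x - dl) (at x)"
        by (auto intro!: derivative_eq_intros E)
      then show "\<exists>y. ((\<lambda>x. E x - dl * x) has_real_derivative y) (at x) \<and> 0 \<le> y"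
        using dl(2)[of x] by (intro exI[of _ "d x - dl"]) simp
    qed
    then show ?thesis by (simp add: algebra_simps)
  qed
  have "z t - c \<le> \<bar>B - c\<bar> * exp (- dl) ^ n" for n
  proof -
    let ?s = "t - real n"
    have "z t - c = (z t - c) * exp (E t) * exp (- E t)" by (simp add: exp_minus)
    also have "\<dots> \<le> (z ?s - c) * exp (E ?s) * exp (- E t)"
      using antimono[of ?s] by (intro mult_right_mono) auto
    also have "\<dots> = (z ?s - c) * exp (E ?s - E t)" by (simp add: exp_diff exp_minus field_simps)
    also have "\<dots> \<le> \<bar>B - c\<bar> * exp (E ?s - E t)"
      using bounded[of ?s] by (intro mult_right_mono) auto
    also have "\<dots> \<le> \<bar>B - c\<bar> * exp (- dl * real n)"
      using growth[of ?s] by (intro mult_left_mono) auto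
    also have "exp (- dl * real n) = exp (- dl) ^ n" by (simp add: exp_of_nat_mult[symmetric] mult.commute)
    finally show ?thesis .
  qed
  moreover have "(\<lambda>n. \<bar>B - c\<bar> * exp (- dl) ^ n) \<longlonglongrightarrow> \<bar>B - c\<bar> * 0"
    using dl(1) by (intro tendsto_mult_left LIMSEQ_realpow_zero) auto
  ultimately have "z t - c \<le> 0" using LIMSEQ_le_const[of _ 0 "z t - c"] by auto
  then show ?thesis by simp
qed

lemma linear_comparison_abs:
  fixes z d r :: "real \<Rightarrow> real"
  assumes z: "\<And>t. (z has_real_derivative - d t * z t + r t) (at t)" and bounded: "\<And>t. \<bar>z t\<bar> \<le> B"
    and d: "continuous_on UNIV d" and dl: "dl > 0" "\<And>t. dl \<le> d t"
    and r: "\<And>t. \<bar>r t\<bar> \<le> d t * c"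
  shows "\<bar>z t\<bar> \<le> c"
proof -
  have "z t \<le> c"
    using bounded r by - (rule linear_comparison[OF z _ d dl], auto simp: abs_le_iff)
  moreover have "- z t \<le> c"
  proof (rule linear_comparison[where z = "\<lambda>t. - z t" and r = "\<lambda>t. - r t", OF _ _ d dl])
    show "((\<lambda>t. - z t) has_real_derivative - d t * - z t + - r t) (at t)" for t
      using DERIV_minus[OF z[of t]] by simp
  qed (use bounded r in \<open>auto simp: abs_le_iff\<close>)
  ultimately show ?thesis by simp
qed

text \<open>With \<open>P' = e\<^sup>E h\<close> and \<open>c = H / dl\<close>, both \<open>P + c e\<^sup>E\<close> and \<open>c e\<^sup>E - P\<close> are non-decreasing, so the
  infimum \<open>L\<close> of the former is within \<open>c e\<^sup>E\<close> of \<open>P\<close>; \<open>L\<close> plays the role of \<open>P(-\<infinity>)\<close>.\<close>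

lemma bounded_solution_exists:
  fixes d h :: "real \<Rightarrow> real"
  assumes d: "continuous_on UNIV d" and dl: "dl > 0" "\<And>t. dl \<le> d t"
    and h: "continuous_on UNIV h" and H: "\<And>t. \<bar>h t\<bar> \<le> H"
  shows "\<exists>z. \<forall>t. (z has_real_derivative - d t * z t + h t) (at t) \<and> \<bar>z t\<bar> \<le> H / dl"
proof -
  obtain E where E: "\<And>t. (E has_real_derivative d t) (at t)"
    using antiderivative_exists[OF d] by blast
  have "continuous_on UNIV E" using E DERIV_continuous_on by blast
  then have "continuous_on UNIV (\<lambda>t. exp (E t) * h t)" by (intro continuous_intros h)
  then obtain P where P: "\<And>t. (P has_real_derivative exp (E t) * h t) (at t)"
    using antiderivative_exists by blast
  define c where "c = H / dl"
  have "0 \<le> H" using H[of 0] by simp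
  then have Hc: "H \<le> c * d t" for t using dl(1) dl(2)[of t] unfolding c_def by (simp add: field_simps mult_left_mono)
  have up: "P s + c * exp (E s) \<le> P t + c * exp (E t)" if "s \<le> t" for s t
  proof (rule DERIV_nonneg_imp_nondecreasing[OF that])
    fix x :: real
    have "((\<lambda>x. P x + c * exp (E x)) has_real_derivative exp (E x) * (h x + c * d x)) (at x)"
      by (auto intro!: derivative_eq_intros P E simp: algebra_simps)
    moreover have "0 \<le> h x + c * d x" using H[of x] Hc[of x] by linarith
    ultimately show "\<exists>y. ((\<lambda>x. P x + c * exp (E x)) has_real_derivative y) (at x) \<and> 0 \<le> y"
      by (meson exp_ge_zero mult_nonneg_nonneg)
  qed
  have down: "c * exp (E s) - P s \<le> c * exp (E t) - P t" if "s \<le> t" for s t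
  proof (rule DERIV_nonneg_imp_nondecreasing[OF that])
    fix x :: real
    have "((\<lambda>x. c * exp (E x) - P x) has_real_derivative exp (E x) * (c * d x - h x)) (at x)"
      by (auto intro!: derivative_eq_intros P E simp: algebra_simps)
    moreover have "0 \<le> c * d x - h x" using H[of x] Hc[of x] by linarith
    ultimately show "\<exists>y. ((\<lambda>x. c * exp (E x) - P x) has_real_derivative y) (at x) \<and> 0 \<le> y"
      by (meson exp_ge_zero mult_nonneg_nonneg)
  qed
  have c0: "0 \<le> c * exp (E t)" for t using \<open>0 \<le> H\<close> dl(1) by (simp add: c_def)
  have lower: "P t - c * exp (E t) \<le> P s + c * exp (E s)" for s t
    using up[of t s] down[of s t] c0[of s] c0[of t] by (cases "s \<le> t") linarith+
  define L where "L = (INF s. P s + c * exp (E s))"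
  have L1: "L \<le> P t + c * exp (E t)" for t
    unfolding L_def using lower[of 0] by (intro cINF_lower bdd_belowI2) auto
  have L2: "P t - c * exp (E t) \<le> L" for t
    unfolding L_def using lower by (intro cINF_greatest) auto
  \<comment> \<open>Variation of constants with lower limit -\<infinity>.\<close>
  let ?z = "\<lambda>t. exp (- E t) * (P t - L)"
  have "(?z has_real_derivative - d t * ?z t + h t) (at t)" for t
    by (auto intro!: derivative_eq_intros P E simp: algebra_simps exp_minus)
  moreover have "\<bar>?z t\<bar> \<le> H / dl" for t
  proof -
    have "\<bar>P t - L\<bar> \<le> c * exp (E t)" using L1[of t] L2[of t] by linarith
    then have "exp (- E t) * \<bar>P t - L\<bar> \<le> exp (- E t) * (c * exp (E t))" by (intro mult_left_mono) auto
    also have "\<dots> = c" by (simp add: exp_minus)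
    finally show ?thesis by (simp add: abs_mult c_def)
  qed
  ultimately show ?thesis by blast
qed

text \<open>Almost periods \<open>p\<^sub>k\<close> of \<open>x\<close> and \<open>q\<^sub>k\<close> of \<open>y\<close> with \<open>p\<^sub>k - q\<^sub>k\<close> bounded: along a convergent subsequence
  of the differences, \<open>p\<^sub>m - p\<^sub>k\<close> is a large common almost period.\<close>

lemma almost_periodic_eqI:
  fixes x y :: "real \<Rightarrow> 'a::real_normed_vector"
  assumes x: "almost_periodic x" and y: "almost_periodic y"
    and lim: "((\<lambda>t. x t - y t) \<longlongrightarrow> 0) at_top"
  shows "x = y"
proof (rule ext, rule ccontr)
  fix t assume "x t \<noteq> y t"
  \<comment> \<open>The estimates below cost 2 + 3 + 1 = 6 \<epsilon>, so dividing by 8 is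
    enough.\<close>
  define \<epsilon> where "\<epsilon> = norm (x t - y t) / 8"
  have e: "\<epsilon> > 0" using \<open>x t \<noteq> y t\<close> by (simp add: \<epsilon>_def)
  obtain l where l: "l > 0" "\<And>\<alpha>. \<exists>\<omega>\<in>{\<alpha>..\<alpha> + l}. \<forall>t. norm (x (t + \<omega>) - x t) < \<epsilon>"
    using x e unfolding almost_periodic_def by metis
  obtain l' where l': "l' > 0" "\<And>\<alpha>. \<exists>\<omega>\<in>{\<alpha>..\<alpha> + l'}. \<forall>t. norm (y (t + \<omega>) - y t) < \<epsilon>"
    using y e unfolding almost_periodic_def by metis
  obtain p where p: "\<And>k. p k \<in> {real k..real k + l}" "\<And>k t. norm (x (t + p k) - x t) < \<epsilon>"
    using l(2)[of "real _"] by metis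
  obtain q where q: "\<And>k. q k \<in> {real k..real k + l'}" "\<And>k t. norm (y (t + q k) - y t) < \<epsilon>"
    using l'(2)[of "real _"] by metis
  have "\<forall>k. p k - q k \<in> {- (l + l')..l + l'}"
  proof
    show "p k - q k \<in> {- (l + l')..l + l'}" for k using p(1)[of k] q(1)[of k] l(1) l'(1) by auto
  qed
  then obtain c and \<rho> :: "nat \<Rightarrow> nat" where \<rho>: "strict_mono \<rho>"
    and c: "(\<lambda>n. p (\<rho> n) - q (\<rho> n)) \<longlonglongrightarrow> c"
    by (rule seq_compactE[OF compact_imp_seq_compact[OF compact_Icc]]) (auto simp: comp_def)
  have "isCont y t"
    using y by (simp add: almost_periodic_def continuous_on_eq_continuous_at)
  then obtain \<delta> where \<delta>: "\<delta> > 0" "\<And>s. \<bar>s - t\<bar> < \<delta> \<Longrightarrow> norm (y s - y t) < \<epsilon>"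
    using e unfolding continuous_at_eps_delta dist_norm real_norm_def by blast
  have "eventually (\<lambda>s. norm (x s - y s) < \<epsilon>) at_top"
    using tendstoD[OF lim e] by simp
  then obtain T where T: "\<And>s. s \<ge> T \<Longrightarrow> norm (x s - y s) < \<epsilon>"
    by (auto simp: eventually_at_top_linorder)
  have "eventually (\<lambda>n. \<bar>p (\<rho> n) - q (\<rho> n) - c\<bar> < \<delta> / 2) sequentially"
    using tendstoD[OF c, of "\<delta> / 2"] \<delta>(1) by (simp add: dist_real_def)
  then obtain N where N: "\<And>n. n \<ge> N \<Longrightarrow> \<bar>p (\<rho> n) - q (\<rho> n) - c\<bar> < \<delta> / 2"
    by (auto simp: eventually_sequentially)
  \<comment> \<open>The later index \<open>?j\<close> must satisfy two demands: the difference p - q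
    is within \<delta>/2 of c, and t + \<omega> lies beyond T. The second follows from
    \<open>p ?j\<close> \<ge> \<open>?j\<close> \<ge> M.\<close>
  obtain M where M: "real M \<ge> T - t + p (\<rho> N)" using real_arch_simple by blast
  let ?i = "\<rho> N" and ?j = "\<rho> (max N M)"
  define \<omega> where "\<omega> = p ?j - p ?i"
  have "M \<le> ?j" using seq_suble[OF \<rho>, of "max N M"] by simp
  then have "T \<le> t + \<omega>" using M p(1)[of ?j] by (simp add: \<omega>_def)
  have "norm (x (t + \<omega>) - x t) < 2 * \<epsilon>"
    using p(2)[where k = ?i and t = "t + \<omega>"] p(2)[where k = ?j and t = t]
      norm_triangle_ineq4[of "x (t + p ?j) - x t" "x (t + p ?j) - x (t + \<omega>)"]
    by (simp add: \<omega>_def algebra_simps)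
  moreover have "norm (y (t + \<omega>) - y t) < 3 * \<epsilon>"
  proof -
    \<comment> \<open>Moving t + \<omega> by the almost periods of y instead of those of x ends at
      s, which differs from t only by the oscillation of p - q; continuity of y at t absorbs
      this.\<close>
    define s where "s = t + \<omega> - (q ?j - q ?i)"
    have "s - t = (p ?j - q ?j - c) - (p ?i - q ?i - c)" by (simp add: \<omega>_def s_def)
    moreover have "\<bar>p ?i - q ?i - c\<bar> < \<delta> / 2" "\<bar>p ?j - q ?j - c\<bar> < \<delta> / 2" by (rule N; simp)+
    ultimately have "\<bar>s - t\<bar> < \<delta>" by linarith
    then have "dist (y s) (y t) < \<epsilon>" unfolding dist_norm by (rule \<delta>(2))
    moreover have "dist (y (s + q ?j)) (y s) < \<epsilon>" "dist (y (t + \<omega> + q ?i)) (y (t + \<omega>)) < \<epsilon>"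
      unfolding dist_norm by (rule q(2))+
    moreover have "s + q ?j = t + \<omega> + q ?i" by (simp add: s_def)
    ultimately have "dist (y (t + \<omega>)) (y t) < 3 * \<epsilon>"
      using dist_triangle3[of "y (t + \<omega>)" "y t" "y (s + q ?j)"] dist_triangle[of "y (s + q ?j)" "y t" "y s"]
      by (simp only:)
    then show ?thesis by (simp only: dist_norm)
  qed
  moreover have "norm (x (t + \<omega>) - y (t + \<omega>)) < \<epsilon>" using T \<open>T \<le> t + \<omega>\<close> by simp
  ultimately have "norm (x t - y t) < 6 * \<epsilon>"
    using dist_triangle3[of "x t" "y t" "x (t + \<omega>)"] dist_triangle[of "x (t + \<omega>)" "y t" "y (t + \<omega>)"]
    unfolding dist_norm by linarith
  then show False using e by (simp add: \<epsilon>_def)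
qed

text \<open>An almost period in [-t, -t + l] moves t into the compact interval [0, l]. A single
  \<epsilon> suffices, so the lemma serves the coefficients as well as almost periodic
  functions.\<close>

lemma recurrent_bounded:
  fixes x :: "real \<Rightarrow> 'a::real_normed_vector"
  assumes x: "continuous_on UNIV x"
    and l: "\<And>\<alpha>. \<exists>\<omega>\<in>{\<alpha>..\<alpha> + l}. \<forall>t. norm (x (t + \<omega>) - x t) < \<epsilon>"
  shows "\<exists>B. \<forall>t. norm (x t) \<le> B"
proof -
  have "compact (x ` {0..l})" using x by (intro compact_continuous_image continuous_on_subset[OF x]) auto
  then have "bounded (x ` {0..l})" by (rule compact_imp_bounded)
  then obtain B where "\<forall>y\<in>x ` {0..l}. norm y \<le> B" unfolding bounded_iff by blast
  then have B: "norm (x s) \<le> B" if "s \<in> {0..l}" for s using that by blast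
  have "norm (x t) \<le> B + \<epsilon>" for t
  proof -
    obtain \<omega> where "\<omega> \<in> {- t..- t + l}" "norm (x (t + \<omega>) - x t) < \<epsilon>" using l by metis
    then show ?thesis using B[of "t + \<omega>"] norm_triangle_ineq2[of "x t" "x (t + \<omega>)"]
      by (auto simp: norm_minus_commute)
  qed
  then show ?thesis by blast
qed

lemma almost_periodic_bounded:
  fixes x :: "real \<Rightarrow> 'b::real_normed_vector"
  assumes "almost_periodic x"
  obtains B where "\<And>t. norm (x t) \<le> B"
proof -
  obtain l where l: "\<forall>\<alpha>. \<exists>\<omega>\<in>{\<alpha>..\<alpha> + l}. \<forall>t. norm (x (t + \<omega>) - x t) < 1"
    using assms unfolding almost_periodic_def by (meson zero_less_one)
  have "\<exists>B. \<forall>t. norm (x t) \<le> B"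
    by (rule recurrent_bounded[where l = l and \<epsilon> = 1])
       (use assms l in \<open>auto simp: almost_periodic_def\<close>)
  then show thesis using that by blast
qed

section \<open>The delay system\<close>

lemma finite_family_bounded:
  fixes x :: "'n::finite \<Rightarrow> 'b \<Rightarrow> real"
  assumes "\<And>i. \<exists>B. \<forall>t. \<bar>x i t\<bar> \<le> B"
  obtains B where "\<And>i t. \<bar>x i t\<bar> \<le> B" "0 \<le> B"
proof -
  obtain b where b: "\<And>i t. \<bar>x i t\<bar> \<le> b i" using assms by metis
  have "\<bar>x i t\<bar> \<le> (\<Sum>i\<in>UNIV. \<bar>b i\<bar>)" for i t
    using b[of i t] member_le_sum[of i UNIV "\<lambda>i. \<bar>b i\<bar>"] by simp
  then show thesis using that by (meson abs_ge_zero sum_nonneg)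
qed

lemma ls_abs_diff_commute: "ls_abs (\<lambda>s. k s - l s) = ls_abs (\<lambda>s. l s - k s)"
proof -
  have "\<bar>(k x - l x) - (k y - l y)\<bar> = \<bar>(l x - k x) - (l y - k y)\<bar>" for x y by linarith
  then show ?thesis
    unfolding ls_abs_def variation_fun_def[abs_def] variation_def variation_sums_def by presburger
qed

lemma lipschitz_continuous:
  fixes \<phi> :: "real \<Rightarrow> real"
  assumes "\<And>x y. \<bar>\<phi> x - \<phi> y\<bar> \<le> L * \<bar>x - y\<bar>" "0 < L"
  shows "continuous_on UNIV \<phi>"
proof -
  have "L-lipschitz_on UNIV \<phi>" using assms by (intro lipschitz_onI) (auto simp: dist_real_def)
  then show ?thesis by (rule lipschitz_on_continuous_on)
qed

locale delay_system =
  fixes d I g f :: "'n::finite \<Rightarrow> real \<Rightarrow> real"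
    and a \<tau> :: "'n \<Rightarrow> 'n \<Rightarrow> real \<Rightarrow> real"
    and K :: "'n \<Rightarrow> 'n \<Rightarrow> real \<Rightarrow> real \<Rightarrow> real"
    and Kb :: "'n \<Rightarrow> 'n \<Rightarrow> real \<Rightarrow> real"
    and dl G F :: "'n \<Rightarrow> real"
  assumes A: "assumption_A d a g f \<tau> K I dl G F Kb"
begin

lemmas parts = A[unfolded assumption_A_def]
lemmas parts_g = parts[THEN conjunct1]
lemmas parts_f = parts[THEN conjunct2, THEN conjunct1]
lemmas parts_dI = parts[THEN conjunct2, THEN conjunct2, THEN conjunct1]
lemmas parts_atau = parts[THEN conjunct2, THEN conjunct2, THEN conjunct2, THEN conjunct1]
lemmas parts_dl = parts[THEN conjunct2, THEN conjunct2, THEN conjunct2, THEN conjunct2, THEN conjunct1]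
lemmas parts_K = parts[THEN conjunct2, THEN conjunct2, THEN conjunct2, THEN conjunct2, THEN conjunct2, THEN conjunct1]
lemmas parts_periods = parts[THEN conjunct2, THEN conjunct2, THEN conjunct2, THEN conjunct2, THEN conjunct2, THEN conjunct2, THEN conjunct1]
lemmas parts_Kb = parts[THEN conjunct2, THEN conjunct2, THEN conjunct2, THEN conjunct2, THEN conjunct2, THEN conjunct2, THEN conjunct2, THEN conjunct1]
lemmas parts_moment = parts[THEN conjunct2, THEN conjunct2, THEN conjunct2, THEN conjunct2, THEN conjunct2, THEN conjunct2, THEN conjunct2, THEN conjunct2, THEN conjunct1]
lemmas parts_null = parts[THEN conjunct2, THEN conjunct2, THEN conjunct2, THEN conjunct2, THEN conjunct2, THEN conjunct2, THEN conjunct2, THEN conjunct2, THEN conjunct2]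

lemma G_pos: "G j > 0" and F_pos: "F j > 0" and dl_pos: "dl i > 0" and d_ge: "dl i \<le> d i t"
  and \<tau>_nonneg: "0 \<le> \<tau> i j t"
  and cont: "continuous_on UNIV (d i)" "continuous_on UNIV (I i)" "continuous_on UNIV (a i j)"
    "continuous_on UNIV (\<tau> i j)"
  using parts_g parts_f parts_dI parts_atau parts_dl by blast+

lemma g_lipschitz: "\<bar>g j x - g j y\<bar> \<le> G j * \<bar>x - y\<bar>"
proof -
  have "\<bar>g j (y + (x - y)) - g j y\<bar> \<le> G j * \<bar>x - y\<bar>"
    using parts_g by blast
  then show ?thesis by simp
qed

lemma f_lipschitz: "\<bar>f j x - f j y\<bar> \<le> F j * \<bar>x - y\<bar>"
proof -
  have "\<bar>f j (y + (x - y)) - f j y\<bar> \<le> F j * \<bar>x - y\<bar>"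
    using parts_f by blast
  then show ?thesis by simp
qed

lemma cont_g: "continuous_on UNIV (g j)" and cont_f: "continuous_on UNIV (f j)"
  by (rule lipschitz_continuous[OF g_lipschitz G_pos], rule lipschitz_continuous[OF f_lipschitz F_pos])

definition almost_period :: "real \<Rightarrow> real \<Rightarrow> bool" where
  "almost_period \<epsilon> \<omega> \<longleftrightarrow> (\<forall>i j t.
        \<bar>d i (t + \<omega>) - d i t\<bar> < \<epsilon> \<and>
        \<bar>a i j (t + \<omega>) - a i j t\<bar> < \<epsilon> \<and>
        \<bar>I i (t + \<omega>) - I i t\<bar> < \<epsilon> \<and>
        \<bar>\<tau> i j (t + \<omega>) - \<tau> i j t\<bar> < \<epsilon> \<and>
        emeasure (ls_abs (\<lambda>s. K i j (t + \<omega>) s - K i j t s)) {0..} < ennreal \<epsilon>)"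

lemma almost_periods: "\<epsilon> > 0 \<Longrightarrow> \<exists>l>0. \<forall>\<alpha>. \<exists>\<omega>\<in>{\<alpha>..\<alpha> + l}. almost_period \<epsilon> \<omega>"
  using parts_periods unfolding almost_period_def by blast

text \<open>The weight e^(\<epsilon> s) is at least 1 on \<open>{0..}\<close>, so the exponential
  moment bounds the total mass.\<close>

lemma finite_Kb: "emeasure (ls_abs (Kb i j)) {0..} < \<infinity>"
proof -
  obtain \<epsilon> where e: "\<epsilon> > 0" "set_integrable (ls_abs (Kb i j)) {0..} (\<lambda>s. exp (\<epsilon> * s))"
    using parts_moment by blast
  have "emeasure (ls_abs (Kb i j)) {0..} = (\<integral>\<^sup>+s. indicator {0..} s \<partial>ls_abs (Kb i j))"
    by simp
  also have "\<dots> \<le> (\<integral>\<^sup>+s. ennreal (norm (indicator {0..} s *\<^sub>R exp (\<epsilon> * s))) \<partial>ls_abs (Kb i j))"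
    using e(1) by (intro nn_integral_mono) (auto simp: indicator_def)
  also have "\<dots> < \<infinity>"
    using e(2) unfolding set_integrable_def integrable_iff_bounded by blast
  finally show ?thesis .
qed

lemma family: "ls_family (K i j) (Kb i j)"
proof
  show "emeasure (ls_abs (Kb i j)) {0..} < \<infinity>" by (rule finite_Kb)
qed (use parts_K parts_Kb parts_null in \<open>blast+\<close>)

lemma coefficient_bounds:
  obtains C where "0 \<le> C" "\<And>i t. \<bar>d i t\<bar> \<le> C" "\<And>i t. \<bar>I i t\<bar> \<le> C"
    "\<And>i j t. \<bar>a i j t\<bar> \<le> C" "\<And>i j t. \<tau> i j t \<le> C"
proof -
  obtain l where l: "\<forall>\<alpha>. \<exists>\<omega>\<in>{\<alpha>..\<alpha> + l}. almost_period 1 \<omega>" using almost_periods[of 1] by auto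
  have "\<exists>B. \<forall>t. norm (d i t) \<le> B" "\<exists>B. \<forall>t. norm (I i t) \<le> B" "\<exists>B. \<forall>t. norm (a i j t) \<le> B"
    "\<exists>B. \<forall>t. norm (\<tau> i j t) \<le> B" for i j
    by (rule recurrent_bounded[where l = l and \<epsilon> = 1, OF cont(1)]
        recurrent_bounded[where l = l and \<epsilon> = 1, OF cont(2)]
        recurrent_bounded[where l = l and \<epsilon> = 1, OF cont(3)]
        recurrent_bounded[where l = l and \<epsilon> = 1, OF cont(4)];
        use l in \<open>unfold almost_period_def real_norm_def, blast\<close>)+
  \<comment> \<open>Uncurrying the two indices lets \<open>finite_family_bounded\<close> treat them
    as one finite index.\<close>
  then have b: "\<exists>B. \<forall>t. \<bar>d i t\<bar> \<le> B" "\<exists>B. \<forall>t. \<bar>I i t\<bar> \<le> B" "\<exists>B. \<forall>t. \<bar>case_prod a ij t\<bar> \<le> B"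
    "\<exists>B. \<forall>t. \<bar>case_prod \<tau> ij t\<bar> \<le> B" for i ij
    by (auto simp: real_norm_def split: prod.split)
  obtain B1 where B1: "\<And>i t. \<bar>d i t\<bar> \<le> B1" "0 \<le> B1" using finite_family_bounded[where x = "d", OF b(1)] by metis
  obtain B2 where B2: "\<And>i t. \<bar>I i t\<bar> \<le> B2" "0 \<le> B2" using finite_family_bounded[where x = "I", OF b(2)] by metis
  obtain B3 where B3: "\<And>ij t. \<bar>case_prod a ij t\<bar> \<le> B3" "0 \<le> B3" using finite_family_bounded[where x = "case_prod a", OF b(3)] by metis
  obtain B4 where B4: "\<And>ij t. \<bar>case_prod \<tau> ij t\<bar> \<le> B4" "0 \<le> B4" using finite_family_bounded[where x = "case_prod \<tau>", OF b(4)] by metis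
  show thesis
  proof (rule that[of "B1 + B2 + B3 + B4"])
    show "\<bar>d i t\<bar> \<le> B1 + B2 + B3 + B4" "\<bar>I i t\<bar> \<le> B1 + B2 + B3 + B4" for i t
      using B1(1)[of i t] B2(1)[of i t] B1(2) B2(2) B3(2) B4(2) by linarith+
    show "\<bar>a i j t\<bar> \<le> B1 + B2 + B3 + B4" "\<tau> i j t \<le> B1 + B2 + B3 + B4" for i j t
      using B3(1)[of "(i, j)" t] B4(1)[of "(i, j)" t] B1(2) B2(2) B3(2) B4(2) by auto
  qed (use B1(2) B2(2) B3(2) B4(2) in simp)
qed

lemma bdd_coefficients: "bdd_above (range (\<tau> i j))" "bdd_above (range (\<lambda>t. \<bar>a i j t\<bar>))"
proof -
  obtain C where "\<And>i j t. \<bar>a i j t\<bar> \<le> C" "\<And>i j t. \<tau> i j t \<le> C"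
    using coefficient_bounds by metis
  then show "bdd_above (range (\<tau> i j))" "bdd_above (range (\<lambda>t. \<bar>a i j t\<bar>))"
    by (auto intro!: bdd_aboveI2[where M = C])
qed

text \<open>The left-hand side is monotone in each quantity replaced: \<open>dl\<close> \<le>
  \<open>d\<close>, the coefficient is at most its supremum, and |dK(t, .)| \<le> |dK|. The same
  domination yields the finite moments.\<close>

lemma condition_uniform_imp_condition_t:
  assumes \<xi>: "\<And>i. \<xi> i > 0" and u: "condition_uniform dl a \<tau> Kb G F \<xi> \<beta>"
  shows "condition_t d a \<tau> K G F \<xi> \<beta>"
  unfolding condition_t_def
proof (intro allI impI conjI)
  fix t :: real and i
  have Kb: "set_integrable (ls_abs (Kb i j)) {0..} (\<lambda>s. exp (\<beta> * s))" for j
    using u unfolding condition_uniform_def by blast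
  note K = ls_abs_integral_mono[OF ls_family.dom[OF family] Kb, of _ t]
  show "set_integrable (ls_abs (K i j t)) {0..} (\<lambda>s. exp (\<beta> * s))" for j by (rule K(1))
  have "- (d i t - \<beta>) * \<xi> i
      + (\<Sum>j\<in>UNIV. \<bar>a i j t\<bar> * G j * \<xi> j)
      + (\<Sum>j\<in>UNIV. F j * \<xi> j * exp (\<beta> * (SUP r. \<tau> i j r)) *
           (LINT s:{0..}|ls_abs (K i j t). exp (\<beta> * s)))
    \<le> - (dl i - \<beta>) * \<xi> i
      + (\<Sum>j\<in>UNIV. (SUP r. \<bar>a i j r\<bar>) * G j * \<xi> j)
      + (\<Sum>j\<in>UNIV. F j * \<xi> j * exp (\<beta> * (SUP r. \<tau> i j r)) *
           (LINT s:{0..}|ls_abs (Kb i j). exp (\<beta> * s)))"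
  proof (intro add_mono sum_mono mult_right_mono mult_left_mono K(2))
    show "\<bar>a i j t\<bar> \<le> (SUP r. \<bar>a i j r\<bar>)" for j
      using bdd_coefficients(2) by (rule cSUP_upper[OF UNIV_I])
  qed (use d_ge[of i t] \<xi> F_pos G_pos in \<open>auto simp: less_imp_le intro!: mult_nonneg_nonneg\<close>)
  also have "\<dots> < 0" using u unfolding condition_uniform_def by blast
  finally show "- (d i t - \<beta>) * \<xi> i
      + (\<Sum>j\<in>UNIV. \<bar>a i j t\<bar> * G j * \<xi> j)
      + (\<Sum>j\<in>UNIV. F j * \<xi> j * exp (\<beta> * (SUP r. \<tau> i j r)) *
           (LINT s:{0..}|ls_abs (K i j t). exp (\<beta> * s))) < 0" .
qed

section \<open>The forcing term and the solution operator on bounded continuous functions\<close>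

definition bdd_cont :: "('n \<Rightarrow> real \<Rightarrow> real) \<Rightarrow> bool" where
  "bdd_cont u \<longleftrightarrow> (\<forall>i. continuous_on UNIV (u i)) \<and> (\<exists>B. \<forall>i t. \<bar>u i t\<bar> \<le> B)"

definition delayed :: "('n \<Rightarrow> real \<Rightarrow> real) \<Rightarrow> 'n \<Rightarrow> 'n \<Rightarrow> real \<Rightarrow> real \<Rightarrow> real" where
  "delayed u i j t s = f j (u j (t - \<tau> i j t - s))"

definition forcing :: "('n \<Rightarrow> real \<Rightarrow> real) \<Rightarrow> 'n \<Rightarrow> real \<Rightarrow> real" where
  "forcing u i t = (\<Sum>j\<in>UNIV. a i j t * g j (u j t))
     + (\<Sum>j\<in>UNIV. ls_integral (K i j t) (delayed u i j t)) + I i t"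

definition mass :: "'n \<Rightarrow> 'n \<Rightarrow> real \<Rightarrow> real" where
  "mass i j t = measure (ls_abs (K i j t)) {0..}"

lemma mass_nonneg: "0 \<le> mass i j t" by (simp add: mass_def)

lemma mass_bound:
  obtains C where "\<And>i j t. mass i j t \<le> C" "0 \<le> C"
proof -
  have "mass i j t \<le> (\<Sum>i\<in>UNIV. \<Sum>j\<in>UNIV. measure (ls_abs (Kb i j)) {0..})" for i j t
  proof -
    have "mass i j t \<le> measure (ls_abs (Kb i j)) {0..}"
      unfolding mass_def by (rule ls_family.measure_le[OF family])
    also have "\<dots> \<le> (\<Sum>j\<in>UNIV. measure (ls_abs (Kb i j)) {0..})"
      by (rule member_le_sum) auto
    also have "\<dots> \<le> (\<Sum>i\<in>UNIV. \<Sum>j\<in>UNIV. measure (ls_abs (Kb i j)) {0..})"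
      by (rule member_le_sum) (auto intro!: sum_nonneg)
    finally show ?thesis .
  qed
  then show thesis using that by (meson measure_nonneg sum_nonneg)
qed

lemma compose_lipschitz_bounded:
  assumes "bdd_cont u" and L: "\<And>j x y. \<bar>\<phi> j x - \<phi> j y\<bar> \<le> L j * \<bar>x - y\<bar>" "\<And>j. (0::real) < L j"
  obtains B where "\<And>j t. \<bar>\<phi> j (u j t)\<bar> \<le> B" "0 \<le> B"
proof -
  obtain B where B: "\<And>i t. \<bar>u i t\<bar> \<le> B" using assms(1) by (auto simp: bdd_cont_def)
  have "\<exists>B. \<forall>t. \<bar>\<phi> j (u j t)\<bar> \<le> B" for j
  proof (intro exI allI)
    fix t
    have "\<bar>\<phi> j (u j t) - \<phi> j 0\<bar> \<le> L j * \<bar>u j t\<bar>" using L(1)[of j "u j t" 0] by simp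
    also have "\<dots> \<le> L j * B" using B L(2)[of j] by (intro mult_left_mono) auto
    finally show "\<bar>\<phi> j (u j t)\<bar> \<le> L j * B + \<bar>\<phi> j 0\<bar>" by linarith
  qed
  then show thesis using finite_family_bounded[of "\<lambda>j t. \<phi> j (u j t)"] that by metis
qed

lemma continuous_delayed:
  assumes "bdd_cont u"
  shows "continuous_on UNIV (delayed u i j t)" "continuous_on UNIV (\<lambda>t. delayed u i j t s)"
proof -
  have u: "continuous_on UNIV (u j)" using assms by (simp add: bdd_cont_def)
  show "continuous_on UNIV (delayed u i j t)" "continuous_on UNIV (\<lambda>t. delayed u i j t s)"
    unfolding delayed_def[abs_def]
    by (intro continuous_on_compose2[OF cont_f] continuous_on_compose2[OF u] continuous_intros cont; simp)+
qed

lemma measurable_delayed: "bdd_cont u \<Longrightarrow> delayed u i j t \<in> borel_measurable borel"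
  by (rule borel_measurable_continuous_onI[OF continuous_delayed(1)])

lemma delayed_bound:
  assumes "bdd_cont u" obtains B where "\<And>i j t s. \<bar>delayed u i j t s\<bar> \<le> B" "0 \<le> B"
  unfolding delayed_def
  by (rule compose_lipschitz_bounded[where \<phi> = f and L = F, OF assms f_lipschitz F_pos]) blast

text \<open>The times of kernel and integrand are decoupled because an integrand taken at t +
  \<omega> has to be integrated against the kernel at t.\<close>

lemma integrable_delayed:
  assumes u: "bdd_cont u" shows "set_integrable (ls_abs (K i j t)) {0..} (delayed u i j t')"
proof -
  obtain B where "\<And>i j t s. \<bar>delayed u i j t s\<bar> \<le> B" using delayed_bound[OF u] by metis
  then show ?thesis by (rule ls_family.integrable_bounded[OF family measurable_delayed[OF u]])
qed

lemma continuous_forcing: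
  assumes u: "bdd_cont u" shows "continuous_on UNIV (forcing u i)"
proof -
  obtain B where B: "\<And>i j t s. \<bar>delayed u i j t s\<bar> \<le> B" using delayed_bound[OF u] by metis
  have uc: "continuous_on UNIV (u j)" for j using u by (simp add: bdd_cont_def)
  have "continuous_on UNIV (\<lambda>t. ls_integral (K i j t) (delayed u i j t))" for j
    by (rule ls_family.continuous_ls_integral[OF family continuous_delayed[OF u] B])
  then show ?thesis
    unfolding forcing_def[abs_def]
    by (intro continuous_intros cont continuous_on_compose2[OF cont_g uc]) auto
qed

lemma forcing_bound:
  assumes u: "bdd_cont u" obtains H where "\<And>i t. \<bar>forcing u i t\<bar> \<le> H"
proof -
  obtain B where B: "\<And>i j t s. \<bar>delayed u i j t s\<bar> \<le> B" "0 \<le> B" using delayed_bound[OF u] by metis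
  obtain B' where B': "\<And>j t. \<bar>g j (u j t)\<bar> \<le> B'" "0 \<le> B'"
    using compose_lipschitz_bounded[where \<phi> = g and L = G, OF u g_lipschitz G_pos] by metis
  obtain C where C: "0 \<le> C" "\<And>i t. \<bar>I i t\<bar> \<le> C" "\<And>i j t. \<bar>a i j t\<bar> \<le> C"
    using coefficient_bounds by metis
  obtain M where M: "\<And>i j t. mass i j t \<le> M" "0 \<le> M" using mass_bound by metis
  have "\<bar>forcing u i t\<bar> \<le> (\<Sum>j\<in>(UNIV::'n set). C * B') + (\<Sum>j\<in>(UNIV::'n set). B * M) + C" for i t
  proof -
    have "\<bar>\<Sum>j\<in>UNIV. a i j t * g j (u j t)\<bar> \<le> (\<Sum>j\<in>(UNIV::'n set). C * B')"
      by (rule order_trans[OF sum_abs sum_mono]) (auto simp: abs_mult intro!: mult_mono C B')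
    moreover have "\<bar>\<Sum>j\<in>UNIV. ls_integral (K i j t) (delayed u i j t)\<bar> \<le> (\<Sum>j\<in>(UNIV::'n set). B * M)"
    proof (rule order_trans[OF sum_abs sum_mono])
      fix j
      have "\<bar>ls_integral (K i j t) (delayed u i j t)\<bar> \<le> B * mass i j t"
        unfolding mass_def
        by (rule abs_ls_integral_le_bound[OF ls_family.ls[OF family] ls_family.fin'[OF family]
            measurable_delayed[OF u] B(1)])
      also have "\<dots> \<le> B * M" using B(2) M(1) by (intro mult_left_mono)
      finally show "\<bar>ls_integral (K i j t) (delayed u i j t)\<bar> \<le> B * M" .
    qed
    ultimately show ?thesis unfolding forcing_def using C(2)[of i t] by linarith
  qed
  then show thesis using that by blast
qed

text \<open>The image of \<open>u\<close> under the operator whose fixed points are the bounded solutions on the line.\<close>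

definition image_of :: "('n \<Rightarrow> real \<Rightarrow> real) \<Rightarrow> ('n \<Rightarrow> real \<Rightarrow> real) \<Rightarrow> bool" where
  "image_of u y \<longleftrightarrow> (\<forall>i t. (y i has_real_derivative - d i t * y i t + forcing u i t) (at t)) \<and>
     (\<exists>B. \<forall>i t. \<bar>y i t\<bar> \<le> B)"

lemma image_of_bdd_cont:
  assumes "image_of u y" shows "bdd_cont y"
proof -
  have "isCont (y i) t" for i t
    using assms DERIV_isCont unfolding image_of_def by blast
  then show ?thesis
    using assms by (simp add: bdd_cont_def image_of_def continuous_on_eq_continuous_at)
qed

lemma image_of_exists:
  assumes u: "bdd_cont u" shows "\<exists>y. image_of u y"
proof -
  obtain H where H: "\<And>i t. \<bar>forcing u i t\<bar> \<le> H" using forcing_bound[OF u] by metis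
  have "\<exists>z. \<forall>t. (z has_real_derivative - d i t * z t + forcing u i t) (at t) \<and> \<bar>z t\<bar> \<le> H / dl i" for i
    by (rule bounded_solution_exists[OF cont(1) dl_pos d_ge continuous_forcing[OF u] H])
  then obtain y where y: "\<And>i t. (y i has_real_derivative - d i t * y i t + forcing u i t) (at t)"
    "\<And>i t. \<bar>y i t\<bar> \<le> H / dl i" by metis
  then have "\<exists>B. \<forall>t. \<bar>y i t\<bar> \<le> B" for i by blast
  then obtain B where "\<And>i t. \<bar>y i t\<bar> \<le> B" using finite_family_bounded[of y] by metis
  then show ?thesis using y(1) unfolding image_of_def by blast
qed

end

section \<open>The fixed point\<close>

text \<open>Iterating N \<mapsto> q N + e drives a bound to the fixed point e / (1 - q). The
  predicate \<open>P\<close> stands for a bound valid for all indices and times, from which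
  \<open>le\<close> extracts one instance.\<close>

lemma contraction_iterate:
  fixes q e N0 x y :: real
  assumes "P N0" and step: "\<And>N. P N \<Longrightarrow> P (q * N + e)" and le: "\<And>N. P N \<Longrightarrow> y \<le> N * x"
    and q: "0 \<le> q" "q < 1"
  shows "y \<le> e / (1 - q) * x"
proof -
  let ?b = "e / (1 - q)"
  have fixed: "q * ?b + e = ?b" using q by (simp add: field_simps)
  have "P (?b + q ^ k * (N0 - ?b))" for k
  proof (induction k)
    case (Suc k)
    have "q * (?b + q ^ k * (N0 - ?b)) + e = (q * ?b + e) + q ^ Suc k * (N0 - ?b)"
      by (simp add: algebra_simps)
    then show ?case using step[OF Suc] by (simp only: fixed)
  qed (use assms(1) in simp)
  then have "y \<le> (?b + q ^ k * (N0 - ?b)) * x" for k by (rule le)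
  moreover have "(\<lambda>k. (?b + q ^ k * (N0 - ?b)) * x) \<longlonglongrightarrow> (?b + 0 * (N0 - ?b)) * x"
    using q by (intro tendsto_intros LIMSEQ_realpow_zero) auto
  ultimately show ?thesis using LIMSEQ_le_const by fastforce
qed

locale stable_delay_system = delay_system d I g f a \<tau> K Kb dl G F
  for d I g f :: "'n::finite \<Rightarrow> real \<Rightarrow> real" and a \<tau> K Kb dl G F +
  fixes \<xi> :: "'n \<Rightarrow> real" and \<beta> :: real
  assumes \<xi>_pos: "\<And>i. \<xi> i > 0" and \<beta>_pos: "\<beta> > 0"
    and condition: "condition_t d a \<tau> K G F \<xi> \<beta>"
begin

text \<open>The Lipschitz constant of \<open>forcing\<close> at (i, t) for the \<xi>-weighted sup
  norm; see \<open>forcing_lipschitz\<close>.\<close>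

definition gain :: "'n \<Rightarrow> real \<Rightarrow> real" where
  "gain i t = (\<Sum>j\<in>UNIV. \<bar>a i j t\<bar> * G j * \<xi> j) + (\<Sum>j\<in>UNIV. F j * \<xi> j * mass i j t)"

lemma G\<xi>: "0 \<le> G j * \<xi> j" and F\<xi>: "0 \<le> F j * \<xi> j"
  using G_pos[of j] F_pos[of j] \<xi>_pos[of j] by auto

lemma moment:
  assumes "t > 0"
  shows "set_integrable (ls_abs (K i j t)) {0..} (\<lambda>s. exp (\<beta> * s))"
    and "- (d i t - \<beta>) * \<xi> i
        + (\<Sum>j\<in>UNIV. \<bar>a i j t\<bar> * G j * \<xi> j)
        + (\<Sum>j\<in>UNIV. F j * \<xi> j * exp (\<beta> * (SUP r. \<tau> i j r)) *
             (LINT s:{0..}|ls_abs (K i j t). exp (\<beta> * s))) < 0"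
  using condition assms unfolding condition_t_def by blast+

lemma exp_\<tau>_le: "exp (\<beta> * \<tau> i j t) \<le> exp (\<beta> * (SUP r. \<tau> i j r))"
  using \<beta>_pos cSUP_upper[OF UNIV_I bdd_coefficients(1), of i j t] by simp

lemma gain_le_pos:
  assumes t: "t > 0" shows "gain i t \<le> (d i t - \<beta>) * \<xi> i"
proof -
  have "mass i j t \<le> exp (\<beta> * (SUP r. \<tau> i j r)) * (LINT s:{0..}|ls_abs (K i j t). exp (\<beta> * s))" for j
  proof -
    have "mass i j t = (LINT s:{0..}|ls_abs (K i j t). 1)"
      by (simp add: mass_def set_lebesgue_integral_def)
    also have "\<dots> \<le> (LINT s:{0..}|ls_abs (K i j t). exp (\<beta> * s))"
      using \<beta>_pos
      by (intro set_integral_mono moment(1)[OF t] ls_family.integrable_bounded[OF family, where B = 1]) auto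
    finally have 1: "mass i j t \<le> (LINT s:{0..}|ls_abs (K i j t). exp (\<beta> * s))" .
    have "1 \<le> exp (\<beta> * (SUP r. \<tau> i j r))"
      using exp_\<tau>_le[of i j t] \<tau>_nonneg[of i j t] \<beta>_pos by (auto intro: order_trans[rotated])
    from mult_mono[OF this 1] mass_nonneg[of i j t] show ?thesis by simp
  qed
  then have "(\<Sum>j\<in>UNIV. F j * \<xi> j * mass i j t) \<le> (\<Sum>j\<in>UNIV. F j * \<xi> j * (exp (\<beta> * (SUP r. \<tau> i j r)) *
      (LINT s:{0..}|ls_abs (K i j t). exp (\<beta> * s))))"
    by (intro sum_mono mult_left_mono F\<xi>)
  then show ?thesis using moment(2)[OF t, of i] unfolding gain_def by (simp add: algebra_simps)
qed

lemma measure_ls_abs_less: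
  assumes "almost_period \<epsilon> \<omega>" "\<epsilon> > 0"
  shows "measure (ls_abs (\<lambda>s. K i j (t + \<omega>) s - K i j t s)) {0..} < \<epsilon>"
    "emeasure (ls_abs (\<lambda>s. K i j (t + \<omega>) s - K i j t s)) {0..} < \<infinity>"
proof -
  have *: "emeasure (ls_abs (\<lambda>s. K i j (t + \<omega>) s - K i j t s)) {0..} < ennreal \<epsilon>"
    using assms(1) by (simp add: almost_period_def)
  then show "emeasure (ls_abs (\<lambda>s. K i j (t + \<omega>) s - K i j t s)) {0..} < \<infinity>"
    by (simp add: less_trans[OF _ ennreal_less_top])
  then show "measure (ls_abs (\<lambda>s. K i j (t + \<omega>) s - K i j t s)) {0..} < \<epsilon>"
    using * assms(2) by (simp add: emeasure_eq_ennreal_measure ennreal_less_iff top.not_eq_extremum)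
qed

lemma mass_almost_period:
  assumes "almost_period \<epsilon> \<omega>" "\<epsilon> > 0"
  shows "mass i j t \<le> mass i j (t + \<omega>) + \<epsilon>"
proof -
  let ?D = "ls_abs (\<lambda>s. K i j (t + \<omega>) s - K i j t s)"
  note ls = ls_family.ls[OF family, of i j] and fin = ls_family.fin'[OF family, of i j]
  have "emeasure (ls_abs (K i j t)) {0..} \<le> emeasure (ls_abs (K i j (t + \<omega>))) {0..} + emeasure ?D {0..}"
    using ls_abs_triangle[OF ls ls, of "{0..}" t "t + \<omega>"] by (simp add: ls_abs_diff_commute[of "K i j t"])
  then have "mass i j t \<le> mass i j (t + \<omega>) + measure ?D {0..}"
    using fin[of t] fin[of "t + \<omega>"] measure_ls_abs_less(2)[OF assms, of i j t]
    by (simp add: mass_def emeasure_eq_ennreal_measure top.not_eq_extremum ennreal_plus[symmetric]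
        del: ennreal_plus)
  then show ?thesis using measure_ls_abs_less(1)[OF assms, of i j t] by simp
qed

lemma gain_le: "gain i t \<le> (d i t - \<beta>) * \<xi> i"
proof -
  \<comment> \<open>\<open>C\<close> collects what an error \<delta> is multiplied by: \<xi>_i from
    d, G_j \<xi>_j from the a_ij, F_j \<xi>_j from the masses.\<close>
  define C where "C = \<xi> i + (\<Sum>j\<in>UNIV. G j * \<xi> j) + (\<Sum>j\<in>UNIV. F j * \<xi> j)"
  have "0 < C" unfolding C_def using \<xi>_pos[of i] by (intro add_pos_nonneg sum_nonneg G\<xi> F\<xi>)
  have "gain i t \<le> (d i t - \<beta>) * \<xi> i + e" if e: "e > 0" for e
  proof -
    define \<delta> where "\<delta> = e / C"
    have \<delta>: "\<delta> > 0" "\<delta> * C = e" using e \<open>0 < C\<close> by (auto simp: \<delta>_def)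
    obtain l where l: "\<forall>\<alpha>. \<exists>\<omega>\<in>{\<alpha>..\<alpha> + l}. almost_period \<delta> \<omega>" using almost_periods[OF \<delta>(1)] by blast
    \<comment> \<open>Then t + \<omega> \<ge> 1 > 0, where the hypothesis applies.\<close>
    obtain \<omega> where \<omega>: "1 - t \<le> \<omega>" "almost_period \<delta> \<omega>"
      using l[THEN spec, of "1 - t"] by auto
    have close: "\<bar>d i (t + \<omega>) - d i t\<bar> < \<delta>" "\<bar>a i j (t + \<omega>) - a i j t\<bar> < \<delta>" for j
      using \<omega>(2) by (auto simp: almost_period_def)
    have "gain i t \<le> (\<Sum>j\<in>UNIV. (\<bar>a i j (t + \<omega>)\<bar> + \<delta>) * (G j * \<xi> j))
        + (\<Sum>j\<in>UNIV. F j * \<xi> j * (mass i j (t + \<omega>) + \<delta>))"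
      unfolding gain_def mult.assoc[of _ "G _"]
    proof (intro add_mono sum_mono mult_right_mono mult_left_mono G\<xi> F\<xi> mass_almost_period \<omega>(2) \<delta>(1))
      show "\<bar>a i j t\<bar> \<le> \<bar>a i j (t + \<omega>)\<bar> + \<delta>" for j using close(2)[of j] by linarith
    qed
    also have "\<dots> = gain i (t + \<omega>) + \<delta> * (\<Sum>j\<in>UNIV. G j * \<xi> j) + \<delta> * (\<Sum>j\<in>UNIV. F j * \<xi> j)"
      unfolding gain_def by (simp add: algebra_simps sum.distrib sum_distrib_left)
    also have "gain i (t + \<omega>) \<le> (d i (t + \<omega>) - \<beta>) * \<xi> i" using \<omega>(1) by (intro gain_le_pos) simp
    also have "\<dots> \<le> (d i t + \<delta> - \<beta>) * \<xi> i"
      using close(1) \<xi>_pos[of i] by (intro mult_right_mono) auto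
    finally show ?thesis unfolding \<delta>(2)[symmetric] C_def by (simp add: algebra_simps)
  qed
  then show ?thesis by (rule field_le_epsilon)
qed

lemma gain_nonneg: "0 \<le> gain i t"
  unfolding gain_def mult.assoc[of _ "G _"]
  by (intro add_nonneg_nonneg sum_nonneg mult_nonneg_nonneg[OF _ G\<xi>] mult_nonneg_nonneg[OF F\<xi>] mass_nonneg abs_ge_zero)

text \<open>\<open>d - \<beta> \<le> q d\<close> with \<open>q = 1 - \<beta> / sup d\<close>.\<close>

lemma contraction_factor:
  obtains q where "0 \<le> q" "q < 1" "\<And>i t. gain i t \<le> d i t * (q * \<xi> i)"
proof -
  obtain C where C: "\<And>i t. \<bar>d i t\<bar> \<le> C" using coefficient_bounds by metis
  \<comment> \<open>Nonnegativity of the gain forces \<beta> \<le> d, which is what makes q \<ge>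
    0.\<close>
  have \<beta>d: "\<beta> \<le> d i t" for i t
  proof -
    have "0 \<le> (d i t - \<beta>) * \<xi> i" using gain_nonneg gain_le order_trans by blast
    then show ?thesis using \<xi>_pos[of i] by (simp add: zero_le_mult_iff)
  qed
  \<comment> \<open>Here \<open>undefined\<close> is just some index.\<close>
  have "\<beta> \<le> C" using \<beta>d[of undefined 0] C[of undefined 0] by linarith
  then have "0 < C" using \<beta>_pos by linarith
  show thesis
  proof (rule that[of "1 - \<beta> / C"])
    show "0 \<le> 1 - \<beta> / C" "1 - \<beta> / C < 1" using \<open>\<beta> \<le> C\<close> \<open>0 < C\<close> \<beta>_pos by auto
    fix i t
    have "d i t * \<beta> \<le> C * \<beta>" using C[of i t] \<beta>_pos by (intro mult_right_mono) auto
    then have "d i t * (\<beta> / C) \<le> \<beta>" using \<open>0 < C\<close> by (simp add: field_simps)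
    then have "(d i t - \<beta>) * \<xi> i \<le> (d i t - d i t * (\<beta> / C)) * \<xi> i"
      using \<xi>_pos[of i] by (intro mult_right_mono) auto
    then show "gain i t \<le> d i t * ((1 - \<beta> / C) * \<xi> i)"
      using gain_le[of i t] by (simp add: algebra_simps)
  qed
qed

lemma forcing_lipschitz:
  assumes u: "bdd_cont u" and w: "bdd_cont w" and N: "\<And>j t. \<bar>u j t - w j t\<bar> \<le> N * \<xi> j"
  shows "\<bar>forcing u i t - forcing w i t\<bar> \<le> N * gain i t"
proof -
  have "\<bar>\<Sum>j\<in>UNIV. a i j t * g j (u j t) - a i j t * g j (w j t)\<bar> \<le> (\<Sum>j\<in>UNIV. N * (\<bar>a i j t\<bar> * G j * \<xi> j))"
  proof (rule order_trans[OF sum_abs sum_mono])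
    fix j
    have "\<bar>a i j t * g j (u j t) - a i j t * g j (w j t)\<bar> = \<bar>a i j t\<bar> * \<bar>g j (u j t) - g j (w j t)\<bar>"
      by (simp add: abs_mult[symmetric] right_diff_distrib)
    also have "\<dots> \<le> \<bar>a i j t\<bar> * (G j * (N * \<xi> j))"
      using G_pos[of j] by (intro mult_left_mono order_trans[OF g_lipschitz] N) auto
    finally show "\<bar>a i j t * g j (u j t) - a i j t * g j (w j t)\<bar> \<le> N * (\<bar>a i j t\<bar> * G j * \<xi> j)"
      by (simp add: mult_ac)
  qed
  moreover have "\<bar>\<Sum>j\<in>UNIV. ls_integral (K i j t) (delayed u i j t) - ls_integral (K i j t) (delayed w i j t)\<bar>
    \<le> (\<Sum>j\<in>UNIV. N * (F j * \<xi> j * mass i j t))"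
  proof (rule order_trans[OF sum_abs sum_mono])
    fix j
    let ?h = "\<lambda>s. delayed u i j t s - delayed w i j t s"
    have "\<bar>?h s\<bar> \<le> F j * (N * \<xi> j)" for s
      unfolding delayed_def using F_pos[of j]
      by (intro order_trans[OF f_lipschitz] mult_left_mono N) auto
    then have "\<bar>ls_integral (K i j t) ?h\<bar> \<le> F j * (N * \<xi> j) * mass i j t"
      unfolding mass_def using measurable_delayed[OF u] measurable_delayed[OF w]
      by (intro abs_ls_integral_le_bound[OF ls_family.ls[OF family] ls_family.fin'[OF family]]) auto
    then show "\<bar>ls_integral (K i j t) (delayed u i j t) - ls_integral (K i j t) (delayed w i j t)\<bar>
        \<le> N * (F j * \<xi> j * mass i j t)"
      using ls_integral_diff[OF ls_family.ls[OF family] integrable_delayed[OF u] integrable_delayed[OF w]]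
      by (simp add: mult_ac)
  qed
  moreover have "forcing u i t - forcing w i t
    = (\<Sum>j\<in>UNIV. a i j t * g j (u j t) - a i j t * g j (w j t))
      + (\<Sum>j\<in>UNIV. ls_integral (K i j t) (delayed u i j t) - ls_integral (K i j t) (delayed w i j t))"
    unfolding forcing_def sum_subtractf by simp
  ultimately show ?thesis
    unfolding gain_def distrib_left sum_distrib_left by linarith
qed

text \<open>The difference y - z solves the linear equation whose source is the difference of the
  forcings. This source is at most N \<open>gain\<close> \<le> d (q N \<xi>), which is the form
  required by the comparison lemma.\<close>

lemma image_of_contraction:
  assumes q: "\<And>i t. gain i t \<le> d i t * (q * \<xi> i)" and u: "bdd_cont u" and w: "bdd_cont w"
    and y: "image_of u y" and z: "image_of w z"
    and N: "\<And>j t. \<bar>u j t - w j t\<bar> \<le> N * \<xi> j"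
  shows "\<bar>y i t - z i t\<bar> \<le> q * N * \<xi> i"
proof -
  obtain B1 B2 where B: "\<And>i t. \<bar>y i t\<bar> \<le> B1" "\<And>i t. \<bar>z i t\<bar> \<le> B2"
    using y z by (auto simp: image_of_def)
  have "0 \<le> N * \<xi> i" using abs_ge_zero N order_trans by blast
  then have "0 \<le> N" using \<xi>_pos[of i] by (simp add: zero_le_mult_iff)
  show ?thesis
  proof (rule linear_comparison_abs[where z = "\<lambda>t. y i t - z i t" and d = "d i"
        and r = "\<lambda>t. forcing u i t - forcing w i t", OF _ _ cont(1) dl_pos d_ge])
    fix t
    show "((\<lambda>t. y i t - z i t) has_real_derivative
        - d i t * (y i t - z i t) + (forcing u i t - forcing w i t)) (at t)"
      using y z unfolding image_of_def by (auto intro!: derivative_eq_intros simp: algebra_simps)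
    show "\<bar>y i t - z i t\<bar> \<le> B1 + B2" using B(1)[of i t] B(2)[of i t] by linarith
    have "\<bar>forcing u i t - forcing w i t\<bar> \<le> N * gain i t" by (rule forcing_lipschitz[OF u w N])
    also have "\<dots> \<le> N * (d i t * (q * \<xi> i))" using q \<open>0 \<le> N\<close> by (rule mult_left_mono)
    finally show "\<bar>forcing u i t - forcing w i t\<bar> \<le> d i t * (q * N * \<xi> i)" by (simp add: mult_ac)
  qed
qed

lemma bdd_cont_diff_bound:
  assumes "bdd_cont u" "bdd_cont w"
  obtains N where "\<And>j t. \<bar>u j t - w j t\<bar> \<le> N * \<xi> j" "0 \<le> N"
proof -
  obtain B1 B2 where B: "\<And>i t. \<bar>u i t\<bar> \<le> B1" "\<And>i t. \<bar>w i t\<bar> \<le> B2"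
    using assms by (auto simp: bdd_cont_def)
  have "\<exists>B. \<forall>t. \<bar>(u j t - w j t) / \<xi> j\<bar> \<le> B" for j
  proof (intro exI allI)
    fix t
    have "\<bar>u j t - w j t\<bar> \<le> B1 + B2" using B(1)[of j t] B(2)[of j t] by linarith
    then show "\<bar>(u j t - w j t) / \<xi> j\<bar> \<le> (B1 + B2) / \<xi> j"
      using \<xi>_pos[of j] by (simp add: abs_divide divide_right_mono)
  qed
  then obtain N where N: "\<And>j t. \<bar>(u j t - w j t) / \<xi> j\<bar> \<le> N" "0 \<le> N"
    using finite_family_bounded[where x = "\<lambda>j t. (u j t - w j t) / \<xi> j"] by metis
  have "\<bar>u j t - w j t\<bar> \<le> N * \<xi> j" for j t
    using N(1)[of j t] \<xi>_pos[of j] by (simp add: abs_divide pos_divide_le_eq)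
  then show thesis using that N(2) by blast
qed

section \<open>Picard iteration\<close>

definition picard :: "nat \<Rightarrow> 'n \<Rightarrow> real \<Rightarrow> real" where
  "picard n = ((\<lambda>u. SOME y. image_of u y) ^^ n) (\<lambda>_ _. 0)"

lemma picard: "bdd_cont (picard n)" "image_of (picard n) (picard (Suc n))"
proof -
  have 1: "image_of (picard n) (picard (Suc n))" if "bdd_cont (picard n)" for n
    using someI_ex[OF image_of_exists[OF that]] by (simp add: picard_def)
  have "bdd_cont (picard n)" for n
  proof (induction n)
    case 0
    show ?case by (auto simp: picard_def bdd_cont_def)
  next
    case (Suc n)
    then show ?case using 1 image_of_bdd_cont by blast
  qed
  then show "bdd_cont (picard n)" "image_of (picard n) (picard (Suc n))" using 1 by auto
qed

text \<open>The iterates converge uniformly by the Weierstrass test with majorant q^n N \<xi>_i. No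
  limit is taken in the differential equation: the limit V is compared with its own image y, and the
  contraction puts y as near to iterate M + 1 as V is to iterate M.\<close>

lemma fixed_point_exists: "\<exists>V. bdd_cont V \<and> image_of V V"
proof -
  obtain q where q: "0 \<le> q" "q < 1" "\<And>i t. gain i t \<le> d i t * (q * \<xi> i)"
    using contraction_factor by metis
  obtain N where N: "\<And>j t. \<bar>picard 1 j t - picard 0 j t\<bar> \<le> N * \<xi> j"
    using bdd_cont_diff_bound[OF picard(1) picard(1)] by metis
  have step: "\<bar>picard (Suc n) j t - picard n j t\<bar> \<le> q ^ n * N * \<xi> j" for n j t
  proof (induction n arbitrary: j t)
    case (Suc n)
    show ?case
      using image_of_contraction[OF q(3) picard(1) picard(1) picard(2) picard(2) Suc, of j t]
      by (simp add: mult.assoc)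
  qed (use N in simp)
  define V where "V i t = (\<Sum>n. picard (Suc n) i t - picard n i t)" for i t
  \<comment> \<open>The sum telescopes without remainder because \<open>picard 0\<close> is
    zero.\<close>
  have partial: "(\<Sum>k<n. picard (Suc k) i t - picard k i t) = picard n i t" for n i t
    by (simp add: sum_lessThan_telescope[of "\<lambda>k. picard k i t"]) (simp add: picard_def)
  have unif: "uniform_limit UNIV (\<lambda>n t. picard n i t) (V i) sequentially" for i
  proof -
    have "uniform_limit UNIV (\<lambda>n t. \<Sum>k<n. picard (Suc k) i t - picard k i t)
        (\<lambda>t. \<Sum>k. picard (Suc k) i t - picard k i t) sequentially"
    proof (rule Weierstrass_m_test[where M = "\<lambda>n. q ^ n * (N * \<xi> i)"])
      show "summable (\<lambda>n. q ^ n * (N * \<xi> i))"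
        using q by (intro summable_mult2 summable_geometric) simp
    qed (use step in \<open>simp add: mult.assoc\<close>)
    then show ?thesis by (simp add: partial V_def[abs_def])
  qed
  have close: "\<forall>\<^sub>F n in sequentially. \<forall>i t. \<bar>picard n i t - V i t\<bar> < e * \<xi> i" if "e > 0" for e
  proof -
    have "\<forall>\<^sub>F n in sequentially. \<forall>t\<in>UNIV. dist (picard n i t) (V i t) < e * \<xi> i" for i
      using that \<xi>_pos[of i] by (intro uniform_limitD[OF unif]) simp
    then show ?thesis by (simp add: eventually_all_finite dist_real_def)
  qed
  have "continuous_on UNIV (V i)" for i
    using picard(1) by (intro uniform_limit_theorem[OF _ unif]) (auto simp: bdd_cont_def)
  moreover have "\<exists>B. \<forall>t. \<bar>V i t\<bar> \<le> B" for i
  proof -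
    obtain n where n: "\<And>i t. \<bar>picard n i t - V i t\<bar> < 1 * \<xi> i"
      using eventually_happens'[OF sequentially_bot close[of 1]] by auto
    obtain B where B: "\<And>t. \<bar>picard n i t\<bar> \<le> B" using picard(1)[of n] by (auto simp: bdd_cont_def)
    have "\<bar>V i t\<bar> \<le> B + \<xi> i" for t using n[of i t] B[of t] by linarith
    then show ?thesis by blast
  qed
  ultimately have V: "bdd_cont V" unfolding bdd_cont_def using finite_family_bounded[of V] by metis
  obtain y where y: "image_of V y" using image_of_exists[OF V] by blast
  have "y i t = V i t" for i t
  proof -
    have "\<bar>y i t - V i t\<bar> \<le> 0 + e" if "e > 0" for e
    proof -
      define \<epsilon> where "\<epsilon> = e / (2 * \<xi> i)"
      have \<epsilon>: "\<epsilon> > 0" "2 * (\<epsilon> * \<xi> i) = e" using that \<xi>_pos[of i] by (auto simp: \<epsilon>_def)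
      obtain M where M: "\<And>n i t. n \<ge> M \<Longrightarrow> \<bar>picard n i t - V i t\<bar> < \<epsilon> * \<xi> i"
        using close[OF \<epsilon>(1)] by (auto simp: eventually_sequentially)
      have "\<bar>y i t - picard (Suc M) i t\<bar> \<le> q * \<epsilon> * \<xi> i"
        using M[of M] by (intro image_of_contraction[OF q(3) V picard(1) y picard(2)])
          (auto simp: abs_minus_commute less_imp_le)
      also have "\<dots> \<le> \<epsilon> * \<xi> i" using q \<epsilon>(1) \<xi>_pos[of i] by (simp add: mult_le_cancel_right1)
      finally show ?thesis using M[of "Suc M" i t] \<epsilon>(2) by simp
    qed
    then have "\<bar>y i t - V i t\<bar> \<le> 0" by (rule field_le_epsilon)
    then show ?thesis by simp
  qed
  then have "y = V" by (intro ext)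
  then show ?thesis using V y by blast
qed

section \<open>Almost periodicity and decay\<close>

text \<open>A change of the delays moves the argument of V; this costs O(\<delta>) because the
  equation bounds the derivative of V by \<open>L\<close>, so V is Lipschitz. The perturbed
  contraction N \<mapsto> q N + \<kappa> \<delta> is then iterated to its fixed point.\<close>

lemma fixed_point_almost_period:
  assumes V: "bdd_cont V" "image_of V V"
  obtains \<kappa> where "0 \<le> \<kappa>"
    "\<And>\<delta> \<omega> i t. 0 < \<delta> \<Longrightarrow> almost_period \<delta> \<omega> \<Longrightarrow> \<bar>V i (t + \<omega>) - V i t\<bar> \<le> \<kappa> * \<delta> * \<xi> i"
proof -
  obtain q where q: "0 \<le> q" "q < 1" "\<And>i t. gain i t \<le> d i t * (q * \<xi> i)"
    using contraction_factor by metis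
  obtain B where B: "\<And>i t. \<bar>V i t\<bar> \<le> B" using V(1) by (auto simp: bdd_cont_def)
  have B0: "0 \<le> B" using abs_ge_zero B order_trans by blast
  obtain gB where gB: "\<And>j t. \<bar>g j (V j t)\<bar> \<le> gB" "0 \<le> gB"
    using compose_lipschitz_bounded[where \<phi> = g and L = G, OF V(1) g_lipschitz G_pos] by metis
  obtain fB where fB: "\<And>i j t s. \<bar>delayed V i j t s\<bar> \<le> fB" "0 \<le> fB"
    using delayed_bound[OF V(1)] by metis
  obtain M where M: "\<And>i j t. mass i j t \<le> M" "0 \<le> M" using mass_bound by metis
  obtain H where H: "\<And>i t. \<bar>forcing V i t\<bar> \<le> H" using forcing_bound[OF V(1)] by metis
  obtain C where C: "0 \<le> C" "\<And>i t. \<bar>d i t\<bar> \<le> C" using coefficient_bounds by metis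
  define L where "L = C * B + H"
  have L0: "0 \<le> L" using C(1) B0 H[of undefined 0] unfolding L_def by simp
  have L: "\<bar>V i x - V i y\<bar> \<le> L * \<bar>x - y\<bar>" for i x y
  proof -
    have "norm (- d i t * V i t + forcing V i t) \<le> L" for t
    proof -
      have "\<bar>d i t * V i t\<bar> \<le> C * B" unfolding abs_mult using C B by (intro mult_mono) auto
      then show ?thesis unfolding L_def real_norm_def using H[of i t] by linarith
    qed
    then show ?thesis
      using V(2) field_differentiable_bound[of UNIV "V i" "\<lambda>t. - d i t * V i t + forcing V i t" L x y]
      by (simp add: image_of_def)
  qed
  \<comment> \<open>The cost per unit of \<delta>: \<open>B\<close> for the change of d,
    \<open>gB\<close> for the a_ij, \<open>fB\<close> for the kernels, \<open>F j * L * M\<close>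
    for the delays, 1 for the input.\<close>
  define c where "c = B + (\<Sum>j\<in>(UNIV::'n set). gB) + (\<Sum>j\<in>UNIV. fB + F j * L * M) + 1"
  have c0: "0 \<le> c" unfolding c_def using B0 gB(2) fB(2) L0 M(2) F_pos
    by (intro add_nonneg_nonneg sum_nonneg mult_nonneg_nonneg) (auto simp: less_imp_le)
  \<comment> \<open>Summing over i gives one constant with c \<le> dl_i \<kappa> \<xi>_i for every
    i.\<close>
  define \<kappa> where "\<kappa> = (\<Sum>i\<in>UNIV. c / (dl i * \<xi> i))"
  have \<kappa>i: "c / (dl i * \<xi> i) \<le> \<kappa>" for i
    unfolding \<kappa>_def using c0 dl_pos \<xi>_pos
    by (intro member_le_sum[of i UNIV "\<lambda>i. c / (dl i * \<xi> i)"]) (auto simp: less_imp_le)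
  have "0 \<le> c / (dl i * \<xi> i)" for i using c0 dl_pos[of i] \<xi>_pos[of i] by auto
  then have \<kappa>0: "0 \<le> \<kappa>" unfolding \<kappa>_def by (rule sum_nonneg)
  show thesis
  proof (rule that[of "\<kappa> / (1 - q)"])
    show "0 \<le> \<kappa> / (1 - q)" using \<kappa>0 q by simp
    fix \<delta> \<omega> :: real assume \<delta>: "0 < \<delta>" and \<omega>: "almost_period \<delta> \<omega>"
    define W where "W i t = V i (t + \<omega>)" for i t
    have W: "bdd_cont W"
    proof -
      have "continuous_on UNIV (V i)" for i using V(1) by (simp add: bdd_cont_def)
      then have "continuous_on UNIV (W i)" for i
        unfolding W_def by (rule continuous_on_compose2) (auto intro!: continuous_intros)
      then show ?thesis unfolding bdd_cont_def W_def using B by blast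
    qed
    have W': "(W i has_real_derivative - d i (t + \<omega>) * W i t + forcing V i (t + \<omega>)) (at t)" for i t
      using V(2) DERIV_shift[of "V i" _ t \<omega>] unfolding W_def[abs_def] image_of_def by blast
    have close: "\<bar>d i (t + \<omega>) - d i t\<bar> \<le> \<delta>" "\<bar>a i j (t + \<omega>) - a i j t\<bar> \<le> \<delta>"
      "\<bar>I i (t + \<omega>) - I i t\<bar> \<le> \<delta>" "\<bar>\<tau> i j (t + \<omega>) - \<tau> i j t\<bar> \<le> \<delta>" for i j t
      using \<omega> by (auto simp: almost_period_def less_imp_le)
    \<comment> \<open>The kernel is changed first, with the integrand kept at t + \<omega>; the
      integrand is changed second, against the kernel at t.\<close>
    have delay: "\<bar>ls_integral (K i j (t + \<omega>)) (delayed V i j (t + \<omega>)) - ls_integral (K i j t) (delayed W i j t)\<bar>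
        \<le> \<delta> * (fB + F j * L * M)" for i j t
    proof -
      let ?h = "delayed V i j (t + \<omega>)"
      note ls = ls_family.ls[OF family, of i j]
      have "\<bar>ls_integral (\<lambda>s. K i j (t + \<omega>) s - K i j t s) ?h\<bar>
          \<le> fB * measure (ls_abs (\<lambda>s. K i j (t + \<omega>) s - K i j t s)) {0..}"
        by (rule abs_ls_integral_le_bound[OF ls_integrator_diff[OF ls ls]
            measure_ls_abs_less(2)[OF \<omega> \<delta>] measurable_delayed[OF V(1)] fB(1)])
      also have "\<dots> \<le> fB * \<delta>"
        using measure_ls_abs_less(1)[OF \<omega> \<delta>] fB(2) by (intro mult_left_mono) (auto simp: less_imp_le)
      finally have 1: "\<bar>ls_integral (K i j (t + \<omega>)) ?h - ls_integral (K i j t) ?h\<bar> \<le> fB * \<delta>"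
        unfolding ls_integral_integrator_diff[OF ls ls integrable_delayed[OF V(1)] integrable_delayed[OF V(1)]] .
      have "\<bar>?h s - delayed W i j t s\<bar> \<le> F j * (L * \<delta>)" for s
      proof -
        have "\<bar>?h s - delayed W i j t s\<bar>
            \<le> F j * (L * \<bar>(t + \<omega> - \<tau> i j (t + \<omega>) - s) - (t - \<tau> i j t - s + \<omega>)\<bar>)"
          unfolding delayed_def W_def
          by (rule order_trans[OF f_lipschitz mult_left_mono[OF L less_imp_le[OF F_pos]]])
        also have "(t + \<omega> - \<tau> i j (t + \<omega>) - s) - (t - \<tau> i j t - s + \<omega>) = - (\<tau> i j (t + \<omega>) - \<tau> i j t)"
          by simp
        also have "F j * (L * \<bar>- (\<tau> i j (t + \<omega>) - \<tau> i j t)\<bar>) \<le> F j * (L * \<delta>)"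
          unfolding abs_minus_cancel
          by (rule mult_left_mono[OF mult_left_mono[OF close(4) L0] less_imp_le[OF F_pos]])
        finally show ?thesis .
      qed
      then have "\<bar>ls_integral (K i j t) (\<lambda>s. ?h s - delayed W i j t s)\<bar> \<le> F j * (L * \<delta>) * mass i j t"
        unfolding mass_def using measurable_delayed[OF V(1)] measurable_delayed[OF W]
        by (intro abs_ls_integral_le_bound[OF ls ls_family.fin'[OF family]]) auto
      also have "\<dots> \<le> F j * (L * \<delta>) * M"
        using F_pos[of j] L0 \<delta> by (intro mult_left_mono M(1)) auto
      finally have "\<bar>ls_integral (K i j t) ?h - ls_integral (K i j t) (delayed W i j t)\<bar> \<le> F j * (L * \<delta>) * M"
        unfolding ls_integral_diff[OF ls integrable_delayed[OF V(1)] integrable_delayed[OF W]] .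
      with 1 show ?thesis by (simp add: algebra_simps)
    qed
    have shift: "\<bar>forcing V i (t + \<omega>) - forcing W i t\<bar>
        \<le> \<delta> * ((\<Sum>j\<in>(UNIV::'n set). gB) + (\<Sum>j\<in>UNIV. fB + F j * L * M) + 1)" for i t
    proof -
      have "\<bar>\<Sum>j\<in>UNIV. (a i j (t + \<omega>) - a i j t) * g j (W j t)\<bar> \<le> (\<Sum>j\<in>(UNIV::'n set). \<delta> * gB)"
        unfolding W_def
        by (rule order_trans[OF sum_abs sum_mono]) (auto simp: abs_mult intro!: mult_mono close gB less_imp_le[OF \<delta>])
      moreover have "\<bar>\<Sum>j\<in>UNIV. ls_integral (K i j (t + \<omega>)) (delayed V i j (t + \<omega>)) - ls_integral (K i j t) (delayed W i j t)\<bar>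
          \<le> (\<Sum>j\<in>UNIV. \<delta> * (fB + F j * L * M))"
        by (rule order_trans[OF sum_abs sum_mono[OF delay]])
      moreover have "forcing V i (t + \<omega>) - forcing W i t
        = (\<Sum>j\<in>UNIV. (a i j (t + \<omega>) - a i j t) * g j (W j t))
          + (\<Sum>j\<in>UNIV. ls_integral (K i j (t + \<omega>)) (delayed V i j (t + \<omega>)) - ls_integral (K i j t) (delayed W i j t))
          + (I i (t + \<omega>) - I i t)"
        unfolding forcing_def left_diff_distrib sum_subtractf W_def by simp
      ultimately show ?thesis
        using close(3)[of i t] unfolding distrib_left sum_distrib_left by linarith
    qed
    obtain N0 where N0: "\<And>j t. \<bar>W j t - V j t\<bar> \<le> N0 * \<xi> j" using bdd_cont_diff_bound[OF W V(1)] by metis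
    have step: "\<forall>i t. \<bar>W i t - V i t\<bar> \<le> (q * N + \<kappa> * \<delta>) * \<xi> i"
      if N: "\<forall>i t. \<bar>W i t - V i t\<bar> \<le> N * \<xi> i" for N
    proof (intro allI)
      fix i t
      have "0 \<le> N * \<xi> i" using N abs_ge_zero order_trans by blast
      then have N_nonneg: "0 \<le> N" using \<xi>_pos[of i] by (simp add: zero_le_mult_iff)
      \<comment> \<open>The residual of W - V in the unshifted equation. Inserting the forcing of W
        at t splits it into a perturbation of size O(\<delta>) and a part controlled by the
        contraction.\<close>
      let ?r = "\<lambda>t. (d i t - d i (t + \<omega>)) * W i t + (forcing V i (t + \<omega>) - forcing V i t)"
      show "\<bar>W i t - V i t\<bar> \<le> (q * N + \<kappa> * \<delta>) * \<xi> i"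
      proof (rule linear_comparison_abs[where z = "\<lambda>t. W i t - V i t" and d = "d i" and r = ?r,
            OF _ _ cont(1) dl_pos d_ge])
        fix t
        have V': "(V i has_real_derivative - d i t * V i t + forcing V i t) (at t)"
          using V(2) by (simp add: image_of_def)
        show "((\<lambda>t. W i t - V i t) has_real_derivative - d i t * (W i t - V i t) + ?r t) (at t)"
          using DERIV_diff[OF W' V'] by (simp add: algebra_simps)
        show "\<bar>W i t - V i t\<bar> \<le> N * \<xi> i" using N by blast
        have "\<bar>(d i t - d i (t + \<omega>)) * W i t\<bar> \<le> \<delta> * B"
          unfolding abs_mult W_def using close(1)[of i t] B[of i "t + \<omega>"] \<delta>
          by (intro mult_mono) (auto simp: abs_minus_commute)
        moreover have "\<bar>forcing W i t - forcing V i t\<bar> \<le> N * gain i t"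
          using N by (intro forcing_lipschitz[OF W V(1)]) blast
        moreover have "N * gain i t \<le> N * (d i t * (q * \<xi> i))"
          using q(3) N_nonneg by (rule mult_left_mono)
        moreover have "\<delta> * c = \<delta> * B
            + \<delta> * ((\<Sum>j\<in>(UNIV::'n set). gB) + (\<Sum>j\<in>UNIV. fB + F j * L * M) + 1)"
          unfolding c_def by (simp only: distrib_left add.assoc)
        ultimately have "\<bar>?r t\<bar> \<le> N * (d i t * (q * \<xi> i)) + \<delta> * c"
          using shift[of i t] by linarith
        also have "\<delta> * c \<le> \<delta> * (d i t * (\<kappa> * \<xi> i))"
        proof (intro mult_left_mono)
          have "c = dl i * (c / (dl i * \<xi> i) * \<xi> i)" using dl_pos[of i] \<xi>_pos[of i] by simp
          also have "\<dots> \<le> d i t * (\<kappa> * \<xi> i)"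
            using \<kappa>i[of i] d_ge[of i t] dl_pos[of i] \<xi>_pos[of i] c0
            by (intro mult_mono mult_right_mono) auto
          finally show "c \<le> d i t * (\<kappa> * \<xi> i)" .
        qed (use \<delta> in simp)
        finally show "\<bar>?r t\<bar> \<le> d i t * ((q * N + \<kappa> * \<delta>) * \<xi> i)" by (simp add: algebra_simps)
      qed
    qed
    fix i t
    have "\<bar>W i t - V i t\<bar> \<le> \<kappa> * \<delta> / (1 - q) * \<xi> i"
      by (rule contraction_iterate[where P = "\<lambda>N. \<forall>i t. \<bar>W i t - V i t\<bar> \<le> N * \<xi> i", OF _ step _ q(1,2)])
         (use N0 in auto)
    then show "\<bar>V i (t + \<omega>) - V i t\<bar> \<le> \<kappa> / (1 - q) * \<delta> * \<xi> i" by (simp add: W_def)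
  qed
qed

text \<open>At the first time \<open>t0\<close> where some \<open>|z\<^sub>i| e\<^sup>\<beta>\<^sup>t\<close> reaches \<open>M \<xi>\<^sub>i\<close>, the strict inequality of the
  condition at \<open>t0\<close> makes its derivative negative.\<close>

lemma exponential_decay:
  assumes cu: "\<And>i. continuous_on UNIV (u i)" and cv: "\<And>i. continuous_on UNIV (v i)"
    and u': "\<And>i t. t > 0 \<Longrightarrow> (u i has_real_derivative - d i t * u i t + forcing u i t) (at t)"
    and v': "\<And>i t. t > 0 \<Longrightarrow> (v i has_real_derivative - d i t * v i t + forcing v i t) (at t)"
    and iu: "\<And>i j t. t > 0 \<Longrightarrow> set_integrable (ls_abs (K i j t)) {0..} (delayed u i j t)"
    and iv: "\<And>i j t. t > 0 \<Longrightarrow> set_integrable (ls_abs (K i j t)) {0..} (delayed v i j t)"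
    and M: "0 < M" and past: "\<And>i s. s \<le> 0 \<Longrightarrow> \<bar>u i s - v i s\<bar> * exp (\<beta> * s) < M * \<xi> i"
  shows "\<bar>u i t - v i t\<bar> * exp (\<beta> * t) < M * \<xi> i"
proof (rule ccontr)
  assume contra: "\<not> ?thesis"
  define \<phi> where "\<phi> i s = \<bar>u i s - v i s\<bar> * exp (\<beta> * s)" for i s
  have c\<phi>: "continuous_on UNIV (\<phi> i)" for i
    unfolding \<phi>_def[abs_def] by (intro continuous_intros cu cv)
  \<comment> \<open>A finite union of closed sets, so a first crossing time exists and some index
    attains it.\<close>
  define S where "S = (\<Union>i\<in>UNIV. {s. 0 \<le> s \<and> M * \<xi> i \<le> \<phi> i s})"
  have "closed S"
    unfolding S_def by (intro closed_UN finite ballI closed_Collect_conj closed_Collect_le continuous_intros c\<phi>)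
  moreover have "S \<noteq> {}"
  proof -
    have "0 \<le> t" using contra past[of t i] by linarith
    then have "t \<in> S" using contra unfolding S_def \<phi>_def by (auto simp: not_less)
    then show ?thesis by blast
  qed
  moreover have bdd: "bdd_below S" unfolding S_def by (intro bdd_belowI[of _ 0]) auto
  ultimately have "Inf S \<in> S" by (intro closed_contains_Inf)
  define t0 where "t0 = Inf S"
  obtain i where i: "0 \<le> t0" "M * \<xi> i \<le> \<phi> i t0" using \<open>Inf S \<in> S\<close> unfolding S_def t0_def by auto
  have t0: "0 < t0" using i past[of t0 i] by (cases "t0 = 0") (auto simp: \<phi>_def)
  have before: "\<phi> j s < M * \<xi> j" if "s < t0" for j s
  proof (cases "s \<le> 0")
    case True then show ?thesis using past[of s j] by (simp add: \<phi>_def)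
  next
    case False
    then have "s \<notin> S" using cInf_lower[OF _ bdd, of s] that by (auto simp: t0_def)
    then show ?thesis using False by (auto simp: S_def not_le)
  qed
  have at_t0: "\<phi> j t0 \<le> M * \<xi> j" for j
  proof (rule tendsto_upperbound)
    show "(\<phi> j \<longlongrightarrow> \<phi> j t0) (at_left t0)"
      using c\<phi>[of j] by (simp add: continuous_on_eq_continuous_at isCont_def filterlim_at_split)
    show "\<forall>\<^sub>F s in at_left t0. \<phi> j s \<le> M * \<xi> j"
      using before by (auto simp: eventually_at_left_field less_imp_le intro: exI[of _ "t0 - 1"])
  qed simp
  \<comment> \<open>The bound covers the whole past, hence every delayed argument t0 - \<tau> - s
    with s \<ge> 0.\<close>
  have upto: "\<bar>u j s - v j s\<bar> \<le> M * \<xi> j * exp (- (\<beta> * s))" if "s \<le> t0" for j s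
  proof -
    have "\<phi> j s \<le> M * \<xi> j" using before[of s j] at_t0[of j] that by (cases "s = t0") auto
    then show ?thesis unfolding \<phi>_def by (simp add: exp_minus field_simps)
  qed
  define E where "E = exp (- (\<beta> * t0))"
  define J where "J j = exp (\<beta> * (SUP r. \<tau> i j r)) * (LINT s:{0..}|ls_abs (K i j t0). exp (\<beta> * s))" for j
  have "\<bar>\<Sum>j\<in>UNIV. a i j t0 * g j (u j t0) - a i j t0 * g j (v j t0)\<bar>
      \<le> (\<Sum>j\<in>UNIV. M * E * (\<bar>a i j t0\<bar> * G j * \<xi> j))"
  proof (rule order_trans[OF sum_abs sum_mono])
    fix j
    have "\<bar>a i j t0 * g j (u j t0) - a i j t0 * g j (v j t0)\<bar> = \<bar>a i j t0\<bar> * \<bar>g j (u j t0) - g j (v j t0)\<bar>"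
      by (simp add: abs_mult[symmetric] right_diff_distrib)
    also have "\<dots> \<le> \<bar>a i j t0\<bar> * (G j * (M * \<xi> j * E))"
      unfolding E_def using G_pos[of j]
      by (intro mult_left_mono order_trans[OF g_lipschitz] upto) auto
    finally show "\<bar>a i j t0 * g j (u j t0) - a i j t0 * g j (v j t0)\<bar> \<le> M * E * (\<bar>a i j t0\<bar> * G j * \<xi> j)"
      by (simp add: mult_ac)
  qed
  moreover have "\<bar>\<Sum>j\<in>UNIV. ls_integral (K i j t0) (delayed u i j t0) - ls_integral (K i j t0) (delayed v i j t0)\<bar>
      \<le> (\<Sum>j\<in>UNIV. M * E * (F j * \<xi> j * J j))"
  proof (rule order_trans[OF sum_abs sum_mono])
    fix j
    let ?h = "\<lambda>s. delayed u i j t0 s - delayed v i j t0 s"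
    let ?T = "SUP r. \<tau> i j r"
    have hi: "set_integrable (ls_abs (K i j t0)) {0..} ?h"
      by (intro set_integral_diff iu iv t0)
    have bound: "\<bar>?h s\<bar> \<le> M * E * (F j * \<xi> j) * exp (\<beta> * ?T) * exp (\<beta> * s)" if "s \<in> {0..}" for s
    proof -
      have "\<bar>?h s\<bar> \<le> F j * (M * \<xi> j * exp (- (\<beta> * (t0 - \<tau> i j t0 - s))))"
        unfolding delayed_def using F_pos[of j] \<tau>_nonneg[of i j t0] that
        by (intro order_trans[OF f_lipschitz] mult_left_mono upto) auto
      \<comment> \<open>Shifting the decaying bound back by \<tau> + s produces exactly the weights
        of the condition.\<close>
      also have "\<dots> = M * E * (F j * \<xi> j) * exp (\<beta> * \<tau> i j t0) * exp (\<beta> * s)"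
        by (simp add: E_def exp_add[symmetric] algebra_simps)
      also have "\<dots> \<le> M * E * (F j * \<xi> j) * exp (\<beta> * ?T) * exp (\<beta> * s)"
        using M F\<xi>[of j] by (intro mult_right_mono mult_left_mono exp_\<tau>_le) (auto simp: E_def)
      finally show ?thesis .
    qed
    have "\<bar>ls_integral (K i j t0) ?h\<bar> \<le> (LINT s:{0..}|ls_abs (K i j t0). \<bar>?h s\<bar>)"
      by (rule abs_ls_integral_le[OF ls_family.ls[OF family] hi])
    also have "\<dots> \<le> (LINT s:{0..}|ls_abs (K i j t0). M * E * (F j * \<xi> j) * exp (\<beta> * ?T) * exp (\<beta> * s))"
      by (intro set_integral_mono set_integrable_abs hi set_integrable_mult_right moment(1)[OF t0] bound)
    also have "\<dots> = M * E * (F j * \<xi> j * J j)"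
      by (simp add: J_def mult_ac)
    finally show "\<bar>ls_integral (K i j t0) (delayed u i j t0) - ls_integral (K i j t0) (delayed v i j t0)\<bar>
        \<le> M * E * (F j * \<xi> j * J j)"
      unfolding ls_integral_diff[OF ls_family.ls[OF family] iu[OF t0] iv[OF t0]] .
  qed
  moreover have "forcing u i t0 - forcing v i t0
    = (\<Sum>j\<in>UNIV. a i j t0 * g j (u j t0) - a i j t0 * g j (v j t0))
      + (\<Sum>j\<in>UNIV. ls_integral (K i j t0) (delayed u i j t0) - ls_integral (K i j t0) (delayed v i j t0))"
    unfolding forcing_def sum_subtractf by simp
  ultimately have forcing: "\<bar>forcing u i t0 - forcing v i t0\<bar>
    \<le> M * E * ((\<Sum>j\<in>UNIV. \<bar>a i j t0\<bar> * G j * \<xi> j) + (\<Sum>j\<in>UNIV. F j * \<xi> j * J j))"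
    unfolding distrib_left sum_distrib_left by linarith
  \<comment> \<open>With the sign frozen at t0, \<sigma> (u_i - v_i) is differentiable, equals |u_i
    - v_i| at t0 and is at most |u_i - v_i| elsewhere.\<close>
  define \<sigma> where "\<sigma> = sgn (u i t0 - v i t0)"
  have \<sigma>: "\<bar>\<sigma>\<bar> \<le> 1" "\<sigma> * (u i t0 - v i t0) = \<bar>u i t0 - v i t0\<bar>"
    by (auto simp: \<sigma>_def sgn_if)
  let ?y = "\<lambda>s. \<sigma> * (u i s - v i s) * exp (\<beta> * s)"
  let ?D = "\<sigma> * (- d i t0 * (u i t0 - v i t0) + (forcing u i t0 - forcing v i t0)) * exp (\<beta> * t0)
    + \<beta> * ?y t0"
  have z0: "\<bar>u i t0 - v i t0\<bar> = M * \<xi> i * E"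
    using i(2) at_t0[of i] by (simp add: \<phi>_def E_def exp_minus field_simps)
  have "(?y has_real_derivative ?D) (at t0)"
    by (auto intro!: derivative_eq_intros u'[OF t0] v'[OF t0] simp: algebra_simps)
  moreover have "?D < 0"
  proof -
    have "?D = (- (d i t0 - \<beta>) * (\<sigma> * (u i t0 - v i t0)) + \<sigma> * (forcing u i t0 - forcing v i t0)) * exp (\<beta> * t0)"
      by (simp add: algebra_simps)
    also have "\<dots> \<le> (- (d i t0 - \<beta>) * (M * \<xi> i * E)
        + M * E * ((\<Sum>j\<in>UNIV. \<bar>a i j t0\<bar> * G j * \<xi> j) + (\<Sum>j\<in>UNIV. F j * \<xi> j * J j))) * exp (\<beta> * t0)"
    proof (intro mult_right_mono add_mono)
      have "\<sigma> * (forcing u i t0 - forcing v i t0) \<le> \<bar>\<sigma>\<bar> * \<bar>forcing u i t0 - forcing v i t0\<bar>"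
        by (metis abs_ge_self abs_mult)
      also have "\<dots> \<le> 1 * \<bar>forcing u i t0 - forcing v i t0\<bar>" using \<sigma>(1) by (intro mult_right_mono) auto
      also have "1 * \<bar>forcing u i t0 - forcing v i t0\<bar>
        \<le> M * E * ((\<Sum>j\<in>UNIV. \<bar>a i j t0\<bar> * G j * \<xi> j) + (\<Sum>j\<in>UNIV. F j * \<xi> j * J j))"
        using forcing by simp
      finally show "\<sigma> * (forcing u i t0 - forcing v i t0)
        \<le> M * E * ((\<Sum>j\<in>UNIV. \<bar>a i j t0\<bar> * G j * \<xi> j) + (\<Sum>j\<in>UNIV. F j * \<xi> j * J j))" .
    qed (simp_all add: \<sigma>(2) z0)
    also have "\<dots> = M * E * exp (\<beta> * t0) * (- (d i t0 - \<beta>) * \<xi> i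
        + (\<Sum>j\<in>UNIV. \<bar>a i j t0\<bar> * G j * \<xi> j) + (\<Sum>j\<in>UNIV. F j * \<xi> j * J j))"
      by (simp add: algebra_simps)
    also have "\<dots> < 0"
      using moment(2)[OF t0, of i] M by (intro mult_pos_neg) (auto simp: E_def J_def mult.assoc)
    finally show ?thesis .
  qed
  \<comment> \<open>A negative derivative makes \<open>?y\<close> larger just before t0, which
    contradicts \<open>before\<close>.\<close>
  ultimately obtain e where e: "e > 0" "\<And>h. 0 < h \<Longrightarrow> h < e \<Longrightarrow> ?y t0 < ?y (t0 - h)"
    using DERIV_neg_dec_left by blast
  have "?y t0 < ?y (t0 - e / 2)" using e by simp
  also have "\<dots> \<le> \<phi> i (t0 - e / 2)"
  proof -
    have "\<sigma> * (u i (t0 - e / 2) - v i (t0 - e / 2)) \<le> \<bar>\<sigma>\<bar> * \<bar>u i (t0 - e / 2) - v i (t0 - e / 2)\<bar>"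
      by (metis abs_ge_self abs_mult)
    also have "\<dots> \<le> 1 * \<bar>u i (t0 - e / 2) - v i (t0 - e / 2)\<bar>" using \<sigma>(1) by (intro mult_right_mono) auto
    finally show ?thesis unfolding \<phi>_def by (intro mult_right_mono) auto
  qed
  also have "\<dots> < M * \<xi> i" using before e(1) by simp
  also have "\<dots> \<le> ?y t0" using i(2) \<sigma>(2) by (simp add: \<phi>_def)
  finally show False by simp
qed

section \<open>Decay, existence and uniqueness for vector-valued solutions\<close>

lemma solves_at_iff:
  "solves_at d a g f \<tau> K I u t \<longleftrightarrow>
    (\<forall>i. (\<forall>j. set_integrable (ls_abs (K i j t)) {0..} (delayed (\<lambda>i r. u r $ i) i j t)) \<and>
      ((\<lambda>r. u r $ i) has_real_derivative
        - d i t * u t $ i + forcing (\<lambda>i r. u r $ i) i t) (at t))"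
  unfolding solves_at_def forcing_def delayed_def[abs_def] by (simp only: add.assoc)

lemma solution_decay:
  assumes u: "is_solution d a g f \<tau> K I u"
    and past: "bdd_above ((\<lambda>s. exp (\<beta> * s) * norm (u s)) ` {..0})"
    and v: "is_solution d a g f \<tau> K I v" and B: "\<And>t. norm (v t) \<le> B"
  obtains M where "0 < M" "\<And>i t. \<bar>u t $ i - v t $ i\<bar> * exp (\<beta> * t) < M * \<xi> i"
proof -
  obtain C where C: "\<And>s. s \<le> 0 \<Longrightarrow> exp (\<beta> * s) * norm (u s) \<le> C"
    using past by (auto simp: bdd_above_def)
  have "0 \<le> C" using C[of 0] norm_ge_zero[of "u 0"] by (simp add: order_trans[OF norm_ge_zero])
  have "0 \<le> B" using B[of 0] norm_ge_zero order_trans by blast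
  \<comment> \<open>Each summand alone gives C + B + 1 \<le> M \<xi>_i. \<open>C\<close> bounds the
    weighted history of u, \<open>B\<close> bounds v, and the 1 makes the bound on the past
    strict.\<close>
  define M where "M = (\<Sum>i\<in>UNIV. (C + B + 1) / \<xi> i)"
  have pos: "0 < (C + B + 1) / \<xi> i" for i using \<open>0 \<le> C\<close> \<open>0 \<le> B\<close> \<xi>_pos[of i] by simp
  then have M_pos: "0 < M" unfolding M_def by (intro sum_pos) auto
  have M: "C + B + 1 \<le> M * \<xi> i" for i
  proof -
    have "(C + B + 1) / \<xi> i \<le> M" unfolding M_def
      using pos by (intro member_le_sum) (auto simp: less_imp_le)
    then show ?thesis using \<xi>_pos[of i] by (simp add: pos_divide_le_eq)
  qed
  have past': "\<bar>u s $ i - v s $ i\<bar> * exp (\<beta> * s) < M * \<xi> i" if "s \<le> 0" for i s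
  proof -
    have e1: "exp (\<beta> * s) \<le> 1" using that \<beta>_pos by (simp add: mult_nonneg_nonpos)
    have "\<bar>u s $ i - v s $ i\<bar> \<le> norm (u s) + norm (v s)"
      using component_le_norm_cart[of "u s" i] component_le_norm_cart[of "v s" i] by linarith
    from mult_left_mono[OF this exp_ge_zero[of "\<beta> * s"]]
    have "\<bar>u s $ i - v s $ i\<bar> * exp (\<beta> * s) \<le> exp (\<beta> * s) * norm (u s) + exp (\<beta> * s) * norm (v s)"
      by (simp only: distrib_left mult.commute[of "\<bar>u s $ i - v s $ i\<bar>"])
    also have "exp (\<beta> * s) * norm (v s) \<le> 1 * B"
      using e1 B by (intro mult_mono) auto
    finally show ?thesis using C[OF that] M[of i] by linarith
  qed
  have c: "continuous_on UNIV (\<lambda>t. w t $ i)" if "is_solution d a g f \<tau> K I w" for w i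
    using that unfolding is_solution_def by (intro continuous_intros) auto
  have s: "solves_at d a g f \<tau> K I w t" if "is_solution d a g f \<tau> K I w" "t > 0" for w t
    using that unfolding is_solution_def by blast
  have "\<bar>u t $ i - v t $ i\<bar> * exp (\<beta> * t) < M * \<xi> i" for i t
    using exponential_decay[where u = "\<lambda>i t. u t $ i" and v = "\<lambda>i t. v t $ i" and M = M]
      c[OF u] c[OF v] s[OF u] s[OF v] M_pos past' unfolding solves_at_iff by blast
  then show thesis using that M_pos by blast
qed

lemma solution_decay_bigo:
  assumes M: "\<And>i t. \<bar>u t $ i - v t $ i\<bar> * exp (\<beta> * t) < M * \<xi> i"
  shows "(\<lambda>t. xi_norm \<xi> (u t - v t)) \<in> O[at_top](\<lambda>t. exp (- \<beta> * t))"
proof (rule bigoI[where c = M])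
  have "norm (xi_norm \<xi> (u t - v t)) \<le> M * norm (exp (- \<beta> * t))" for t
  proof -
    have le: "\<bar>inverse (\<xi> i) * (u t - v t) $ i\<bar> \<le> M * exp (- \<beta> * t)" for i
      using M[of t i] \<xi>_pos[of i] by (simp add: abs_mult exp_minus field_simps)
    have "\<bar>inverse (\<xi> undefined) * (u t - v t) $ undefined\<bar> \<le> xi_norm \<xi> (u t - v t)"
      unfolding xi_norm_def by (intro Max_ge) auto
    then have "0 \<le> xi_norm \<xi> (u t - v t)" using abs_ge_zero order_trans by blast
    moreover have "xi_norm \<xi> (u t - v t) \<le> M * exp (- \<beta> * t)"
      unfolding xi_norm_def using le by (intro Max.boundedI) auto
    ultimately show ?thesis by simp
  qed
  then show "\<forall>\<^sub>F t in at_top. norm (xi_norm \<xi> (u t - v t)) \<le> M * norm (exp (- \<beta> * t))"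
    by (intro always_eventually) blast
qed

lemma solution_decay_tendsto:
  assumes M: "\<And>i t. \<bar>u t $ i - v t $ i\<bar> * exp (\<beta> * t) < M * \<xi> i"
  shows "((\<lambda>t. u t - v t) \<longlongrightarrow> 0) at_top"
proof (rule Lim_null_comparison)
  let ?b = "\<lambda>t. \<Sum>i\<in>UNIV. M * \<xi> i * exp (- \<beta> * t)"
  have "norm (u t - v t) \<le> ?b t" for t
  proof (rule order_trans[OF norm_le_l1_cart sum_mono])
    show "\<bar>(u t - v t) $ i\<bar> \<le> M * \<xi> i * exp (- \<beta> * t)" for i
      using M[of t i] by (simp add: exp_minus field_simps)
  qed
  then show "\<forall>\<^sub>F t in at_top. norm (u t - v t) \<le> ?b t" by (intro always_eventually) blast
  have "((\<lambda>t. exp (- \<beta> * t)) \<longlongrightarrow> 0) at_top"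
    using \<beta>_pos
    by (intro filterlim_compose[OF exp_at_bot] filterlim_tendsto_neg_mult_at_bot[OF tendsto_const] filterlim_ident) auto
  then have "(?b \<longlongrightarrow> (\<Sum>i\<in>UNIV. M * \<xi> i * 0)) at_top" by (intro tendsto_sum tendsto_mult_left)
  then show "(?b \<longlongrightarrow> 0) at_top" by simp
qed

lemma almost_periodic_solution_exists:
  obtains v where "almost_periodic v" "\<And>t. solves_at d a g f \<tau> K I v t"
proof -
  obtain V where V: "bdd_cont V" "image_of V V" using fixed_point_exists by blast
  obtain \<kappa> where \<kappa>: "0 \<le> \<kappa>"
    "\<And>\<delta> \<omega> i t. 0 < \<delta> \<Longrightarrow> almost_period \<delta> \<omega> \<Longrightarrow> \<bar>V i (t + \<omega>) - V i t\<bar> \<le> \<kappa> * \<delta> * \<xi> i"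
    using fixed_point_almost_period[OF V] by metis
  define v :: "real \<Rightarrow> real ^ 'n" where "v t = (\<chi> i. V i t)" for t
  have vV: "(\<lambda>i r. v r $ i) = V" by (simp add: v_def)
  have "solves_at d a g f \<tau> K I v t" for t
    unfolding solves_at_iff vV using V integrable_delayed by (simp add: v_def image_of_def)
  moreover have "almost_periodic v"
    unfolding almost_periodic_def
  proof (intro conjI allI impI)
    show "continuous_on UNIV v"
      using V(1) unfolding v_def[abs_def] bdd_cont_def by (intro continuous_on_vec_lambda) auto
    fix \<epsilon> :: real assume \<epsilon>: "\<epsilon> > 0"
    define X where "X = (\<Sum>i\<in>UNIV. \<xi> i)"
    have X: "0 \<le> X" unfolding X_def using \<xi>_pos by (intro sum_nonneg) (auto simp: less_imp_le)
    \<comment> \<open>The added 1 keeps the denominator positive and makes the final estimate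
      strict.\<close>
    define \<delta> where "\<delta> = \<epsilon> / (\<kappa> * X + 1)"
    have p: "0 < \<kappa> * X + 1" using \<kappa>(1) X by (simp add: add_nonneg_pos)
    have \<delta>: "\<delta> > 0" using \<epsilon> p by (simp add: \<delta>_def)
    obtain l where l: "l > 0" "\<forall>\<alpha>. \<exists>\<omega>\<in>{\<alpha>..\<alpha> + l}. almost_period \<delta> \<omega>"
      using almost_periods[OF \<delta>] by blast
    have "norm (v (t + \<omega>) - v t) < \<epsilon>" if \<omega>: "almost_period \<delta> \<omega>" for \<omega> t
    proof -
      have "norm (v (t + \<omega>) - v t) \<le> (\<Sum>i\<in>UNIV. \<kappa> * \<delta> * \<xi> i)"
      proof (rule order_trans[OF norm_le_l1_cart sum_mono])
        show "\<bar>(v (t + \<omega>) - v t) $ i\<bar> \<le> \<kappa> * \<delta> * \<xi> i" for i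
          using \<kappa>(2)[OF \<delta> \<omega>, of i t] by (simp add: v_def)
      qed
      also have "\<dots> = \<delta> * (\<kappa> * X)" by (simp add: X_def sum_distrib_left mult_ac)
      also have "\<dots> < \<delta> * (\<kappa> * X + 1)" using \<delta> by simp
      also have "\<dots> = \<epsilon>" using p by (simp add: \<delta>_def)
      finally show ?thesis .
    qed
    then show "\<exists>l>0. \<forall>\<alpha>. \<exists>\<omega>\<in>{\<alpha>..\<alpha> + l}. \<forall>t. norm (v (t + \<omega>) - v t) < \<epsilon>"
      using l by meson
  qed
  ultimately show thesis using that by blast
qed

text \<open>Almost periodic functions are bounded, so the history of w satisfies the growth
  restriction of \<open>solution_decay\<close>. The difference w - v therefore tends to 0.\<close>

lemma almost_periodic_solution_unique:
  assumes "almost_periodic v" "is_solution d a g f \<tau> K I v"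
    and "almost_periodic w" "is_solution d a g f \<tau> K I w"
  shows "w = v"
proof -
  obtain B where B: "\<And>t. norm (v t) \<le> B" using almost_periodic_bounded[OF assms(1)] by metis
  obtain B' where B': "\<And>t. norm (w t) \<le> B'" using almost_periodic_bounded[OF assms(3)] by metis
  have "bdd_above ((\<lambda>s. exp (\<beta> * s) * norm (w s)) ` {..0})"
  proof (rule bdd_aboveI2)
    fix s :: real assume "s \<in> {..0}"
    then have "exp (\<beta> * s) \<le> 1" using \<beta>_pos by (simp add: mult_nonneg_nonpos)
    from mult_mono[OF this B'] show "exp (\<beta> * s) * norm (w s) \<le> 1 * B'" by simp
  qed
  then obtain M where "\<And>i t. \<bar>w t $ i - v t $ i\<bar> * exp (\<beta> * t) < M * \<xi> i"
    using solution_decay[OF assms(4) _ assms(2) B] by metis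
  then have "((\<lambda>t. w t - v t) \<longlongrightarrow> 0) at_top" by (rule solution_decay_tendsto)
  then show ?thesis by (rule almost_periodic_eqI[OF assms(3,1)])
qed

text \<open>\<open>is_solution\<close> demands the equation for t > 0 only. An arbitrary almost
  periodic solution satisfies it at every t because uniqueness identifies it with the fixed point,
  which solves the system on the whole line.\<close>

lemma almost_periodic_solution:
  "(\<exists>!v. almost_periodic v \<and> is_solution d a g f \<tau> K I v) \<and>
    (\<forall>v. almost_periodic v \<and> is_solution d a g f \<tau> K I v \<longrightarrow>
      (\<forall>t. solves_at d a g f \<tau> K I v t) \<and>
      (\<forall>u. is_solution d a g f \<tau> K I u \<and>
           bdd_above ((\<lambda>s. exp (\<beta> * s) * norm (u s)) ` {..0}) \<longrightarrow>
           (\<lambda>t. xi_norm \<xi> (u t - v t)) \<in> O[at_top](\<lambda>t. exp (- \<beta> * t))))"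
proof -
  obtain v where v: "almost_periodic v" "\<And>t. solves_at d a g f \<tau> K I v t"
    using almost_periodic_solution_exists by blast
  then have sol: "is_solution d a g f \<tau> K I v"
    by (simp add: is_solution_def almost_periodic_def)
  have unique: "w = v" if "almost_periodic w \<and> is_solution d a g f \<tau> K I w" for w
    using almost_periodic_solution_unique[OF v(1) sol] that by blast
  obtain B where B: "\<And>t. norm (v t) \<le> B" using almost_periodic_bounded[OF v(1)] by metis
  have "(\<lambda>t. xi_norm \<xi> (u t - v t)) \<in> O[at_top](\<lambda>t. exp (- \<beta> * t))"
    if u: "is_solution d a g f \<tau> K I u" "bdd_above ((\<lambda>s. exp (\<beta> * s) * norm (u s)) ` {..0})" for u
  proof -
    obtain M where "\<And>i t. \<bar>u t $ i - v t $ i\<bar> * exp (\<beta> * t) < M * \<xi> i"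
      using solution_decay[OF u sol B] by metis
    then show ?thesis by (rule solution_decay_bigo)
  qed
  note bigo = this
  show ?thesis
  proof (intro conjI allI impI)
    show "\<exists>!v. almost_periodic v \<and> is_solution d a g f \<tau> K I v"
      by (rule ex1I[OF _ unique]) (simp_all add: v(1) sol)
    fix w assume w: "almost_periodic w \<and> is_solution d a g f \<tau> K I w"
    show "solves_at d a g f \<tau> K I w t" for t unfolding unique[OF w] by (rule v(2))
    show "(\<lambda>t. xi_norm \<xi> (u t - w t)) \<in> O[at_top](\<lambda>t. exp (- \<beta> * t))"
      if "is_solution d a g f \<tau> K I u \<and> bdd_above ((\<lambda>s. exp (\<beta> * s) * norm (u s)) ` {..0})" for u
      unfolding unique[OF w] using that by (intro bigo) auto
  qed
qed

end

theorem theorem1: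
  fixes d I g f :: "'n::finite \<Rightarrow> real \<Rightarrow> real"
    and a \<tau> :: "'n \<Rightarrow> 'n \<Rightarrow> real \<Rightarrow> real"
    and K :: "'n \<Rightarrow> 'n \<Rightarrow> real \<Rightarrow> real \<Rightarrow> real"
    and Kb :: "'n \<Rightarrow> 'n \<Rightarrow> real \<Rightarrow> real"
    and dl G F \<xi> :: "'n \<Rightarrow> real"
    and \<beta> :: real
  assumes A: "assumption_A d a g f \<tau> K I dl G F Kb"
    and xi_pos: "\<And>i. \<xi> i > 0"
    and beta_pos: "\<beta> > 0"
  shows "(condition_uniform dl a \<tau> Kb G F \<xi> \<beta> \<longrightarrow> condition_t d a \<tau> K G F \<xi> \<beta>) \<and>
    (condition_t d a \<tau> K G F \<xi> \<beta> \<longrightarrow>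
      (\<exists>!v. almost_periodic v \<and> is_solution d a g f \<tau> K I v) \<and>
      (\<forall>v. almost_periodic v \<and> is_solution d a g f \<tau> K I v \<longrightarrow>
        (\<forall>t. solves_at d a g f \<tau> K I v t) \<and>
        (\<forall>u. is_solution d a g f \<tau> K I u \<and>
             bdd_above ((\<lambda>s. exp (\<beta> * s) * norm (u s)) ` {..0}) \<longrightarrow>
             (\<lambda>t. xi_norm \<xi> (u t - v t)) \<in> O[at_top](\<lambda>t. exp (- \<beta> * t)))))"
proof (intro conjI impI)
  assume "condition_uniform dl a \<tau> Kb G F \<xi> \<beta>"
  then show "condition_t d a \<tau> K G F \<xi> \<beta>"
    by (rule delay_system.condition_uniform_imp_condition_t[OF delay_system.intro[OF A] xi_pos])
next
  assume c: "condition_t d a \<tau> K G F \<xi> \<beta>"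
  interpret stable_delay_system d I g f a \<tau> K Kb dl G F \<xi> \<beta>
    by (unfold_locales; fact A xi_pos beta_pos c)
  show "\<exists>!v. almost_periodic v \<and> is_solution d a g f \<tau> K I v"
    using almost_periodic_solution by (rule conjunct1)
  show "\<forall>v. almost_periodic v \<and> is_solution d a g f \<tau> K I v \<longrightarrow>
        (\<forall>t. solves_at d a g f \<tau> K I v t) \<and>
        (\<forall>u. is_solution d a g f \<tau> K I u \<and>
             bdd_above ((\<lambda>s. exp (\<beta> * s) * norm (u s)) ` {..0}) \<longrightarrow>
             (\<lambda>t. xi_norm \<xi> (u t - v t)) \<in> O[at_top](\<lambda>t. exp (- \<beta> * t)))"
    using almost_periodic_solution by (rule conjunct2)
qed

end
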